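(* Assume that $v\in\mathbb{R}$ and $\gamma'(v)>0$. Then for every $(t_0,x_0)\in\mathbb{R}\times\mathbb{T}$, the observability inequality $$\int_{\mathbb{T}}|u_0(x)|^2\,dx\lesssim\int_0^T|u(t_0+t,x_0-vt)|^2\,dt$$ holds for all $T>\frac{2\pi}{\gamma'(v)}$ and all solutions $u$ of $\partial_t u=iP(D)u$, $u(0,x)=u_0(x)\in L^2(\mathbb{T})$, if and only if $\Pi(v)=\emptyset$.
   Context: $\mathbb{T}=\mathbb{R}/2\pi\mathbb{Z}$. Let $p:\mathbb{Z}\to\mathbb{R}$ be an arbitrary real-valued function (not necessarily a polynomial) and let $P(D)$ be the Fourier multiplier on $\mathbb{T}$ with symbol $p$, i.e. $\widehat{P(D)u}(k)=p(k)\widehat u(k)$, where $\widehat u(k)=\frac1{2\pi}\int_0^{2\pi}u(x)e^{-ikx}\,dx$. For $u_0=\sum_{k\in\mathbb{Z}}c_ke^{ikx}\in L^2(\mathbb{T})$, the solution of $\partial_tu=iP(D)u$, $u(0,\cdot)=u_0$, is $u(t,x)=\sum_{k\in\mathbb{Z}}c_ke^{ip(k)t}e^{ikx}$, and the restriction to a line is given by the series $u(t_0+t,x_0-vt)=\sum_{k\in\mathbb{Z}}c_ke^{i(p(k)t_0+kx_0)}e^{i\lambda_k(v)t}$. For $v\in\mathbb{R}$ and $k\in\mathbb{Z}$ put $\lambda_k(v):=p(k)-kv$, $$\Pi(v):=\{k\in\mathbb{Z}:\exists m\in\mathbb{Z},\ m\ne k,\ \lambda_k(v)=\lambda_m(v)\},\qquad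 \Lambda(v):=\{\lambda_k(v):k\in\mathbb{Z}\},$$ $$\gamma'(v):=\sup_{W}\ \inf_{\lambda,\lambda'\in\Lambda(v)\setminus W,\ \lambda\ne\lambda'}|\lambda-\lambda'|,$$ where $W$ runs over all finite subsets of $\Lambda(v)$ ($\gamma'(v)=\infty$ is allowed, with $2\pi/\infty=0$). $A\lesssim B$ means $A\le CB$ with a constant $C>0$ independent of the solution $u$ (it may depend on the other data, such as $p$, $v$, $T$). *)

theory Defs
  imports "HOL-Analysis.Analysis"
begin

text \<open>
  A function on the circle \<open>\<real>/2\<pi>\<int>\<close> is represented by a \<open>2\<pi>\<close>-periodic function on the line, and a
  point of the circle by any real representative. Elements of \<open>L\<^sup>2\<close> are functions, so identities
  between them are meant almost everywhere.
\<close>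

definition L2_circle :: "(real \<Rightarrow> complex) set" where
  "L2_circle = {u. (\<forall>x. u (x + 2 * pi) = u x) \<and> u \<in> borel_measurable lebesgue \<and>
     set_integrable lebesgue {0..2 * pi} (\<lambda>x. (cmod (u x))\<^sup>2)}"

definition fourier_coeff :: "(real \<Rightarrow> complex) \<Rightarrow> int \<Rightarrow> complex" where
  "fourier_coeff u k =
     complex_of_real (1 / (2 * pi)) *
     (LINT x:{0..2 * pi}|lebesgue. u x * exp (- (\<i> * of_int k * of_real x)))"

text \<open>
  For an arbitrary symbol \<open>p\<close> and \<open>u\<close> in \<open>L\<^sup>2\<close>, \<open>P(D) u\<close> need not be a function; it is the object whose
  \<open>k\<close>-th Fourier coefficient is \<open>p k\<close> times that of \<open>u\<close>. Hence \<open>\<partial>\<^sub>t u = i P(D) u\<close> is read on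
  Fourier coefficients. Lemma \<open>fourier_coeff_solution\<close> below recovers the explicit solution formula.
\<close>

definition solution :: "(int \<Rightarrow> real) \<Rightarrow> (real \<Rightarrow> complex) \<Rightarrow> (real \<Rightarrow> real \<Rightarrow> complex) \<Rightarrow> bool" where
  "solution p u0 u \<longleftrightarrow>
     (\<forall>t. u t \<in> L2_circle) \<and>
     (AE x in lebesgue. u 0 x = u0 x) \<and>
     (\<forall>k t. ((\<lambda>s. fourier_coeff (u s) k) has_vector_derivative
               \<i> * (of_real (p k) * fourier_coeff (u t) k)) (at t))"

text \<open>
  A line is a null set, so \<open>u(t\<^sub>0 + t, x\<^sub>0 - v t)\<close> cannot be read off from representatives. It is the
  sum of the Fourier series of \<open>u(t\<^sub>0 + t, \<cdot>)\<close> at \<open>x\<^sub>0 - v t\<close>, as an unconditionally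
  convergent series in \<open>L\<^sup>2(0,T)\<close>. Lemma \<open>line_term_solution\<close> identifies its terms.
\<close>

definition line_term ::
  "(real \<Rightarrow> real \<Rightarrow> complex) \<Rightarrow> real \<Rightarrow> real \<Rightarrow> real \<Rightarrow> int \<Rightarrow> real \<Rightarrow> complex" where
  "line_term u t0 x0 v k t =
     fourier_coeff (u (t0 + t)) k * exp (\<i> * of_int k * of_real (x0 - v * t))"

definition line_restriction ::
  "(real \<Rightarrow> real \<Rightarrow> complex) \<Rightarrow> real \<Rightarrow> real \<Rightarrow> real \<Rightarrow> real \<Rightarrow> (real \<Rightarrow> complex) \<Rightarrow> bool" where
  "line_restriction u t0 x0 v T f \<longleftrightarrow>
     f \<in> borel_measurable lebesgue \<and>
     set_integrable lebesgue {0..T} (\<lambda>t. (cmod (f t))\<^sup>2) \<and>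
     ((\<lambda>F. LINT t:{0..T}|lebesgue. (cmod (f t - (\<Sum>k\<in>F. line_term u t0 x0 v k t)))\<^sup>2)
        \<longlongrightarrow> 0) (finite_subsets_at_top UNIV)"

definition freq :: "(int \<Rightarrow> real) \<Rightarrow> real \<Rightarrow> int \<Rightarrow> real" where
  "freq p v k = p k - of_int k * v"

definition Pi_set :: "(int \<Rightarrow> real) \<Rightarrow> real \<Rightarrow> int set" where
  "Pi_set p v = {k. \<exists>m. m \<noteq> k \<and> freq p v k = freq p v m}"

definition Lambda_set :: "(int \<Rightarrow> real) \<Rightarrow> real \<Rightarrow> real set" where
  "Lambda_set p v = range (freq p v)"

text \<open>Over an empty set of pairs the infimum below is \<open>\<infinity>\<close>.\<close>

definition gamma' :: "(int \<Rightarrow> real) \<Rightarrow> real \<Rightarrow> ereal" where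
  "gamma' p v =
     (SUP W \<in> {W. finite W \<and> W \<subseteq> Lambda_set p v}.
        INF (l, l') \<in> {(l, l'). l \<in> Lambda_set p v - W \<and> l' \<in> Lambda_set p v - W \<and> l \<noteq> l'}.
          ereal \<bar>l - l'\<bar>)"

definition observability_inequality ::
  "(int \<Rightarrow> real) \<Rightarrow> real \<Rightarrow> real \<Rightarrow> real \<Rightarrow> real \<Rightarrow> bool" where
  "observability_inequality p v t0 x0 T \<longleftrightarrow>
     (\<exists>C>0. \<forall>u0\<in>L2_circle. \<forall>u f. solution p u0 u \<longrightarrow> line_restriction u t0 x0 v T f \<longrightarrow>
        (LINT x:{0..2 * pi}|lebesgue. (cmod (u0 x))\<^sup>2)
          \<le> C * (LINT t:{0..T}|lebesgue. (cmod (f t))\<^sup>2))"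

lemma fourier_coeff_cong_AE:
  assumes "u \<in> borel_measurable lebesgue" "w \<in> borel_measurable lebesgue"
    and "AE x in lebesgue. u x = w x"
  shows "fourier_coeff u k = fourier_coeff w k"
proof -
  have e: "(\<lambda>x. exp (- (\<i> * of_int k * complex_of_real x))) \<in> borel_measurable lebesgue"
    by (intro measurable_completion)
       (auto intro!: borel_measurable_continuous_onI continuous_intros)
  have m: "(\<lambda>x. indicat_real {0..2 * pi} x *\<^sub>R (h x * exp (- (\<i> * of_int k * complex_of_real x))))
      \<in> borel_measurable lebesgue" if "h \<in> borel_measurable lebesgue" for h
    by (intro borel_measurable_scaleR borel_measurable_indicator borel_measurable_times that e) auto
  show ?thesis
    unfolding fourier_coeff_def set_lebesgue_integral_def
    by (intro arg_cong2[where f = "(*)"] refl integral_cong_AE m assms(1,2))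
       (use assms(3) in \<open>auto\<close>)
qed

lemma fourier_coeff_solution:
  assumes "solution p u0 u" "u0 \<in> L2_circle"
  shows "fourier_coeff (u t) k = exp (\<i> * of_real (p k * t)) * fourier_coeff u0 k"
proof -
  define g where "g s = exp (- (\<i> * of_real (p k * s))) * fourier_coeff (u s) k" for s
  have "(g has_vector_derivative 0) (at s)" for s
  proof -
    have 1: "((\<lambda>s. exp (- (\<i> * of_real (p k * s)))) has_vector_derivative
        - (\<i> * of_real (p k)) * exp (- (\<i> * of_real (p k * s)))) (at s)"
    proof -
      have "((\<lambda>z. exp (- (\<i> * of_real (p k) * z))) has_field_derivative
        - (\<i> * of_real (p k)) * exp (- (\<i> * of_real (p k) * of_real s))) (at (of_real s))"
        by (auto intro!: derivative_eq_intros)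
      from has_vector_derivative_real_field[OF this] show ?thesis
        by (simp add: mult.assoc)
    qed
    have 2: "((\<lambda>s. fourier_coeff (u s) k) has_vector_derivative
               \<i> * (of_real (p k) * fourier_coeff (u s) k)) (at s)"
      using assms(1) by (auto simp: solution_def)
    show ?thesis
      using has_vector_derivative_mult[OF 1 2] unfolding g_def by (simp add: algebra_simps)
  qed
  then obtain c where c: "\<And>s. g s = c"
    using has_vector_derivative_zero_constant[of UNIV g] by auto
  have "g t = g 0" by (simp add: c)
  moreover have "fourier_coeff (u 0) k = fourier_coeff u0 k"
    using assms by (intro fourier_coeff_cong_AE) (auto simp: solution_def L2_circle_def)
  ultimately have "exp (- (\<i> * of_real (p k * t))) * fourier_coeff (u t) k = fourier_coeff u0 k"
    by (simp add: g_def)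
  then show ?thesis
    by (metis exp_minus_inverse mult.assoc mult_1)
qed

lemma line_term_solution:
  assumes "solution p u0 u" "u0 \<in> L2_circle"
  shows "line_term u t0 x0 v k t =
    fourier_coeff u0 k * exp (\<i> * of_real (p k * t0 + of_int k * x0)) *
      exp (\<i> * of_real (freq p v k * t))"
  unfolding line_term_def fourier_coeff_solution[OF assms] freq_def
  by (simp add: algebra_simps flip: exp_add)

end

theory Submission
  imports Defs
begin

text \<open>
  Along the line a solution is the nonharmonic Fourier series with frequencies \<open>\<lambda>\<^sub>k(v)\<close>. If two modes
  share a frequency, a combination of them vanishes on the line. Otherwise the frequencies are,
  up to a finite set, \<open>\<gamma>\<close>-separated with \<open>T > 2\<pi>/\<gamma>\<close>. Ingham's argument with the weight
  \<open>sin(\<pi>t/T)\<close> on \<open>[0,T]\<close>, whose Gram matrix of exponentials is diagonally dominant, gives the lower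
  bound for the separated part; Haraux's argument adds the exceptional frequencies one at a time
  at the cost of an arbitrarily small increase of \<open>T\<close>. Parseval's identity turns the \<open>\<ell>\<^sup>2\<close> norm of the
  coefficients into the norm of the initial datum.
\<close>

section \<open>Ingham's inequality\<close>

text \<open>The length 2 pi / \<gamma> comes out of one comparison. With w = pi / T the Gram matrix
  has diagonal entry 2 / w and off-diagonal row sums at most 8 w / \<gamma>^2, because the series of
  1 / (4 j^2 - 1) has sum 1/2; dominance then means 2 w < \<gamma>. The same estimate read from
  above bounds the sums on every interval, which is needed twice: to recover the coefficient of an
  added frequency, and to make the series on the line converge. All bounds concern finite sums with
  a constant independent of the index set, so limits enter only at the end. Sums are indexed by the
  frequencies themselves; the modes can be carried over because \<open>freq p v\<close> is injective
  when \<open>Pi_set p v\<close> is empty. Two strict inequalities give the room: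
  \<open>gamma'\<close> is a supremum, so a finite exceptional set and a true gap \<gamma> can be
  chosen with T > 2 pi / \<gamma>, and this inequality in turn pays for the time lost with each
  added frequency. The observability inequality speaks only of solutions that have a restriction to
  the line, so the existence of restrictions is proved as well; otherwise it might hold
  vacuously.\<close>

definition expsum :: "real set \<Rightarrow> (real \<Rightarrow> complex) \<Rightarrow> real \<Rightarrow> complex" where
  "expsum F a t = (\<Sum>l\<in>F. a l * cis (l * t))"

definition separated :: "real \<Rightarrow> real set \<Rightarrow> bool" where
  "separated \<gamma> S \<longleftrightarrow> (\<forall>x\<in>S. \<forall>y\<in>S. x \<noteq> y \<longrightarrow> \<gamma> \<le> \<bar>x - y\<bar>)"

lemma separated_subset: "separated \<gamma> S \<Longrightarrow> F \<subseteq> S \<Longrightarrow> separated \<gamma> F"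
  by (auto simp: separated_def)

lemma continuous_on_expsum [continuous_intros]: "continuous_on A (expsum F a)"
  unfolding expsum_def by (intro continuous_intros)

lemma expsum_integrable: "(\<lambda>t. (cmod (expsum F a t))\<^sup>2) integrable_on {b..c}"
  by (intro integrable_continuous_interval continuous_intros)

lemma cis_has_vector_derivative:
  "((\<lambda>t. cis (x * t)) has_vector_derivative (\<i> * of_real x * cis (x * t))) (at t within A)"
  unfolding cis.ctr has_vector_derivative_complex_iff
  by (auto intro!: derivative_eq_intros)

lemma norm_sum_square_le: "(cmod (x + y))\<^sup>2 \<le> 2 * (cmod x)\<^sup>2 + 2 * (cmod y)\<^sup>2"
proof -
  have "(cmod (x + y))\<^sup>2 \<le> (cmod x + cmod y)\<^sup>2"
    by (intro power_mono norm_triangle_ineq) auto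
  also have "\<dots> \<le> 2 * (cmod x)\<^sup>2 + 2 * (cmod y)\<^sup>2"
    using sum_squares_bound[of "cmod x" "cmod y"] by (simp add: power2_sum)
  finally show ?thesis .
qed

lemma norm_diff_square_le: "(cmod (x - y))\<^sup>2 \<le> 2 * (cmod x)\<^sup>2 + 2 * (cmod y)\<^sup>2"
  using norm_sum_square_le[of x "- y"] by simp

text \<open>The denominator is (2 j - 1) (2 j + 1), so the series telescopes, with total exactly
  1/2. This sharp value is what fixes Ingham's threshold.\<close>

lemma sum_inverse_odd_squares_le:
  fixes J :: "nat set"
  assumes "finite J" "0 \<notin> J"
  shows "(\<Sum>j\<in>J. 1 / (4 * (real j)\<^sup>2 - 1)) \<le> 1 / 2"
proof -
  have *: "(\<Sum>j = 1..n. 1 / (4 * (real j)\<^sup>2 - 1)) = (1 - 1 / (2 * real n + 1)) / 2" for n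
  proof (induction n)
    case (Suc n)
    have "4 * (real (Suc n))\<^sup>2 - 1 = (2 * real n + 1) * (2 * real n + 3)"
      by (simp add: power2_eq_square algebra_simps)
    moreover have "1 / ((2 * x + 1) * (2 * x + 3)) = (1 / (2 * x + 1) - 1 / (2 * x + 3)) / 2"
      if "x \<ge> 0" for x :: real
      using that by (simp add: divide_simps)
    ultimately have h: "1 / (4 * (real (Suc n))\<^sup>2 - 1) = (1 / (2 * real n + 1) - 1 / (2 * real n + 3)) / 2"
      by simp
    have "(\<Sum>j = 1..Suc n. 1 / (4 * (real j)\<^sup>2 - 1)) =
        (\<Sum>j = 1..n. 1 / (4 * (real j)\<^sup>2 - 1)) + 1 / (4 * (real (Suc n))\<^sup>2 - 1)"
      by simp
    also have "\<dots> =
        (1 - 1 / (2 * real n + 1)) / 2 + (1 / (2 * real n + 1) - 1 / (2 * real n + 3)) / 2"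
      by (simp only: Suc h)
    also have "\<dots> = (1 - 1 / (2 * real n + 3)) / 2"
      by (simp add: diff_divide_distrib)
    also have "2 * real n + 3 = 2 * real (Suc n) + 1"
      by simp
    finally show ?case .
  qed simp
  obtain n where "J \<subseteq> {..n}"
    using assms(1) finite_nat_iff_bounded_le by auto
  then have "J \<subseteq> {1..n}"
    using assms(2) by (metis Suc_leI atLeastAtMost_iff atMost_iff gr0I One_nat_def subset_iff)
  moreover have "0 \<le> 1 / (4 * (real j)\<^sup>2 - 1)" if "j \<ge> 1" for j :: nat
  proof -
    have "(real j)\<^sup>2 \<ge> 1" using that by (simp add: one_le_power)
    then show ?thesis by simp
  qed
  ultimately have "(\<Sum>j\<in>J. 1 / (4 * (real j)\<^sup>2 - 1)) \<le> (\<Sum>j = 1..n. 1 / (4 * (real j)\<^sup>2 - 1))"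
    by (intro sum_mono2) auto
  also have "\<dots> \<le> 1 / 2"
    unfolding * by simp
  finally show ?thesis .
qed

text \<open>Mapping m to the integer part n of f m / \<gamma> replaces an enumeration of the points
  in increasing order. From f m >= n \<gamma> and \<omega> < \<gamma> / 2 each term is at most 4 /
  \<gamma>^2 times 1 / (4 n^2 - 1), and the n >= 1 are distinct.\<close>

lemma sum_separated_one_sided:
  fixes f :: "real \<Rightarrow> real"
  assumes "finite G" "\<gamma> > 2 * \<omega>" "\<omega> > 0"
    and inj: "inj_on (\<lambda>m. nat \<lfloor>f m / \<gamma>\<rfloor>) G" and ge: "\<And>m. m \<in> G \<Longrightarrow> f m \<ge> \<gamma>"
  shows "(\<Sum>m\<in>G. 1 / ((f m)\<^sup>2 - \<omega>\<^sup>2)) \<le> 2 / \<gamma>\<^sup>2"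
proof -
  define n where "n m = nat \<lfloor>f m / \<gamma>\<rfloor>" for m
  have "\<gamma> > 0" using assms by simp
  have n1: "n m \<ge> 1" "real (n m) * \<gamma> \<le> f m" if "m \<in> G" for m
  proof -
    have "f m / \<gamma> \<ge> 1" using ge[OF that] \<open>\<gamma> > 0\<close> by simp
    then show "n m \<ge> 1" unfolding n_def by linarith
    have "real (n m) \<le> f m / \<gamma>"
      unfolding n_def using \<open>f m / \<gamma> \<ge> 1\<close> by (simp add: of_nat_nat)
    then show "real (n m) * \<gamma> \<le> f m"
      using \<open>\<gamma> > 0\<close> by (simp add: pos_le_divide_eq)
  qed
  have "(\<Sum>m\<in>G. 1 / ((f m)\<^sup>2 - \<omega>\<^sup>2)) \<le> (\<Sum>m\<in>G. 4 / \<gamma>\<^sup>2 * (1 / (4 * (real (n m))\<^sup>2 - 1)))"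
  proof (intro sum_mono)
    fix m assume m: "m \<in> G"
    have "\<omega>\<^sup>2 \<le> (\<gamma> / 2)\<^sup>2"
      using assms by (intro power_mono) auto
    moreover have "(real (n m) * \<gamma>)\<^sup>2 \<le> (f m)\<^sup>2"
      using n1[OF m] \<open>\<gamma> > 0\<close> by (intro power_mono) auto
    ultimately have "\<gamma>\<^sup>2 / 4 * (4 * (real (n m))\<^sup>2 - 1) \<le> (f m)\<^sup>2 - \<omega>\<^sup>2"
      by (simp add: power_mult_distrib power_divide algebra_simps)
    moreover have "(real (n m))\<^sup>2 \<ge> 1"
      using n1[OF m] by (simp add: one_le_power)
    then have "0 < \<gamma>\<^sup>2 / 4 * (4 * (real (n m))\<^sup>2 - 1)"
      using \<open>\<gamma> > 0\<close> by simp
    ultimately have "1 / ((f m)\<^sup>2 - \<omega>\<^sup>2) \<le> 1 / (\<gamma>\<^sup>2 / 4 * (4 * (real (n m))\<^sup>2 - 1))"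
      by (intro divide_left_mono) auto
    then show "1 / ((f m)\<^sup>2 - \<omega>\<^sup>2) \<le> 4 / \<gamma>\<^sup>2 * (1 / (4 * (real (n m))\<^sup>2 - 1))"
      by simp
  qed
  also have "\<dots> = 4 / \<gamma>\<^sup>2 * (\<Sum>j\<in>n ` G. 1 / (4 * (real j)\<^sup>2 - 1))"
    using inj unfolding n_def by (simp add: sum_distrib_left sum.reindex)
  also have "\<dots> \<le> 4 / \<gamma>\<^sup>2 * (1 / 2)"
    using n1 assms(1) by (intro mult_left_mono sum_inverse_odd_squares_le) force+
  finally show ?thesis by simp
qed

text \<open>The one-sided bound applies to the distances from l to the points on its right and,
  separately, on its left; each side contributes 2 / \<gamma>^2.\<close>

lemma sum_separated_le:
  assumes "finite F" "separated \<gamma> F" "l \<in> F" "\<gamma> > 2 * \<omega>" "\<omega> > 0"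
  shows "(\<Sum>m\<in>F - {l}. 1 / ((l - m)\<^sup>2 - \<omega>\<^sup>2)) \<le> 4 / \<gamma>\<^sup>2"
proof -
  have "\<gamma> > 0" using assms by simp
  \<comment> \<open>Equal integer parts force a distance below \<gamma>, which separation forbids.
    Arguments of size at least \<gamma> have positive floors, on which \<open>nat\<close> is
    injective.\<close>
  have key: "\<bar>x - y\<bar> < \<gamma>" if "nat \<lfloor>x / \<gamma>\<rfloor> = nat \<lfloor>y / \<gamma>\<rfloor>" "x \<ge> \<gamma>" "y \<ge> \<gamma>" for x y :: real
  proof -
    have "x / \<gamma> \<ge> 1" "y / \<gamma> \<ge> 1" using that \<open>\<gamma> > 0\<close> by auto
    then have "\<bar>x / \<gamma> - y / \<gamma>\<bar> < 1" using that(1) by linarith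
    then show ?thesis
      using \<open>\<gamma> > 0\<close> by (simp add: diff_divide_distrib[symmetric] abs_divide)
  qed
  have far: "\<gamma> \<le> \<bar>x - y\<bar>" if "x \<in> F" "y \<in> F" "x \<noteq> y" for x y
    using assms(2) that by (auto simp: separated_def)
  have 1: "(\<Sum>m\<in>{m\<in>F. m > l}. 1 / ((m - l)\<^sup>2 - \<omega>\<^sup>2)) \<le> 2 / \<gamma>\<^sup>2"
  proof (rule sum_separated_one_sided)
    show ge: "m - l \<ge> \<gamma>" if "m \<in> {m\<in>F. m > l}" for m
      using far[of m l] that assms(3) by auto
    show "inj_on (\<lambda>m. nat \<lfloor>(m - l) / \<gamma>\<rfloor>) {m\<in>F. m > l}"
    proof (rule inj_onI, rule ccontr)
      fix x y assume A: "x \<in> {m\<in>F. m > l}" "y \<in> {m\<in>F. m > l}" "x \<noteq> y"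
        "nat \<lfloor>(x - l) / \<gamma>\<rfloor> = nat \<lfloor>(y - l) / \<gamma>\<rfloor>"
      have "\<bar>(x - l) - (y - l)\<bar> < \<gamma>" by (rule key[OF A(4) ge[OF A(1)] ge[OF A(2)]])
      then show False using far[of x y] A by auto
    qed
  qed (use assms in auto)
  have 2: "(\<Sum>m\<in>{m\<in>F. m < l}. 1 / ((l - m)\<^sup>2 - \<omega>\<^sup>2)) \<le> 2 / \<gamma>\<^sup>2"
  proof (rule sum_separated_one_sided)
    show ge: "l - m \<ge> \<gamma>" if "m \<in> {m\<in>F. m < l}" for m
      using far[of m l] that assms(3) by auto
    show "inj_on (\<lambda>m. nat \<lfloor>(l - m) / \<gamma>\<rfloor>) {m\<in>F. m < l}"
    proof (rule inj_onI, rule ccontr)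
      fix x y assume A: "x \<in> {m\<in>F. m < l}" "y \<in> {m\<in>F. m < l}" "x \<noteq> y"
        "nat \<lfloor>(l - x) / \<gamma>\<rfloor> = nat \<lfloor>(l - y) / \<gamma>\<rfloor>"
      have "\<bar>(l - x) - (l - y)\<bar> < \<gamma>" by (rule key[OF A(4) ge[OF A(1)] ge[OF A(2)]])
      then show False using far[of x y] A by auto
    qed
  qed (use assms in auto)
  have "F - {l} = {m\<in>F. m > l} \<union> {m\<in>F. m < l}" using assms(3) by auto
  moreover have "{m\<in>F. m > l} \<inter> {m\<in>F. m < l} = {}" by auto
  ultimately have "(\<Sum>m\<in>F - {l}. 1 / ((l - m)\<^sup>2 - \<omega>\<^sup>2)) =
      (\<Sum>m\<in>{m\<in>F. m > l}. 1 / ((l - m)\<^sup>2 - \<omega>\<^sup>2)) + (\<Sum>m\<in>{m\<in>F. m < l}. 1 / ((l - m)\<^sup>2 - \<omega>\<^sup>2))"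
    using assms(1) by (simp add: sum.union_disjoint)
  also have "\<dots> \<le> 2 / \<gamma>\<^sup>2 + 2 / \<gamma>\<^sup>2"
    using add_mono[OF 1 2] by (simp add: power2_commute[of l])
  finally show ?thesis by simp
qed

text \<open>The Fourier transform of the weight sin(pi t / T) on [0, T]. At x = pi / T and x = - pi
  / T the closed form is 0 / 0, that is 0 here, and differs from the integral; separation keeps all
  frequency differences away from these points.\<close>

definition sine_kernel :: "real \<Rightarrow> real \<Rightarrow> complex" where
  "sine_kernel T x = of_real (pi / T) * (1 + cis (x * T)) / of_real ((pi / T)\<^sup>2 - x\<^sup>2)"

lemma has_integral_sine_kernel:
  assumes "T > 0" "x\<^sup>2 \<noteq> (pi / T)\<^sup>2"
  shows "((\<lambda>t. of_real (sin (pi / T * t)) * cis (x * t)) has_integral sine_kernel T x) {0..T}"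
proof -
  define w where "w = pi / T"
  \<comment> \<open>An antiderivative of the integrand. At the ends of [0, T] the sine vanishes and
    the cosine is 1 and -1, which produces the factor 1 + cis (x T).\<close>
  define A where "A t = (\<i> * of_real x * of_real (sin (w * t)) - of_real w * of_real (cos (w * t)))
    * cis (x * t) / of_real (w\<^sup>2 - x\<^sup>2)" for t
  have wT: "w * T = pi" using assms by (simp add: w_def)
  have nz: "complex_of_real (w\<^sup>2 - x\<^sup>2) \<noteq> 0"
    using assms(2) unfolding of_real_eq_0_iff w_def by simp
  have s: "((\<lambda>t. complex_of_real (sin (w * t))) has_vector_derivative of_real (w * cos (w * t))) (at t within S)" for t S
    by (intro has_vector_derivative_of_real) (auto intro!: derivative_eq_intros)
  have c: "((\<lambda>t. complex_of_real (cos (w * t))) has_vector_derivative of_real (- (w * sin (w * t)))) (at t within S)" for t S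
    by (intro has_vector_derivative_of_real) (auto intro!: derivative_eq_intros)
  have "((\<lambda>t. of_real (sin (w * t)) * cis (x * t)) has_integral (A T - A 0)) {0..T}"
  proof (rule fundamental_theorem_of_calculus)
    fix t
    have 1: "((\<lambda>t. \<i> * of_real x * of_real (sin (w * t)) - of_real w * of_real (cos (w * t)))
       has_vector_derivative (\<i> * of_real x * of_real (w * cos (w * t)) - of_real w * of_real (- (w * sin (w * t)))))
       (at t within {0..T})"
      by (intro has_vector_derivative_diff has_vector_derivative_mult_right s c)
    show "(A has_vector_derivative of_real (sin (w * t)) * cis (x * t)) (at t within {0..T})"
      unfolding A_def
      apply (rule has_vector_derivative_eq_rhs)
       apply (rule has_vector_derivative_divide)
       apply (rule has_vector_derivative_mult[OF 1 cis_has_vector_derivative])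
      using nz by (simp add: field_simps power2_eq_square) 
  qed (use assms in auto)
  moreover have "A T - A 0 = sine_kernel T x"
    unfolding A_def sine_kernel_def w_def[symmetric] wT by (simp add: algebra_simps add_divide_distrib)
  ultimately show ?thesis
    by (simp add: w_def)
qed

text \<open>The decay is quadratic because the weight vanishes at both ends of the interval. A bound
  of order 1 / x, which a constant weight would give, has no bounded row sums.\<close>

lemma norm_sine_kernel_le:
  assumes "T > 0" "\<bar>x\<bar> \<ge> \<gamma>" "\<gamma> > 2 * (pi / T)"
  shows "cmod (sine_kernel T x) \<le> 2 * (pi / T) / (x\<^sup>2 - (pi / T)\<^sup>2)"
proof -
  have "pi / T < \<bar>x\<bar>" using assms(2,3) divide_pos_pos[OF pi_gt_zero assms(1)] by linarith
  then have "(pi / T)\<^sup>2 < \<bar>x\<bar>\<^sup>2" using assms by (intro power_strict_mono) auto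
  moreover have "cmod (1 + cis (x * T)) \<le> 2"
    using norm_triangle_ineq[of 1 "cis (x * T)"] by simp
  then have "pi / T * cmod (1 + cis (x * T)) \<le> pi / T * 2"
    using assms by (intro mult_left_mono) auto
  ultimately show ?thesis
    unfolding sine_kernel_def norm_divide norm_mult norm_of_real
    using assms(1) by (auto simp: divide_simps mult.commute)
qed

lemma sine_kernel_0: "T > 0 \<Longrightarrow> sine_kernel T 0 = of_real (2 / (pi / T))"
  unfolding sine_kernel_def by (simp add: power2_eq_square field_simps)

lemma norm_square_expsum:
  "of_real ((cmod (expsum F a t))\<^sup>2) = (\<Sum>l\<in>F. \<Sum>m\<in>F. a l * cnj (a m) * cis ((l - m) * t))"
  unfolding complex_norm_square expsum_def cnj_sum sum_product
  by (intro sum.cong refl) (simp add: cis_cnj cis_mult algebra_simps)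

text \<open>The Schur test for the Gram matrix: with w = pi / T the diagonal entries are 2 / w, and
  the off-diagonal row sums are at most 2 w times 4 / \<gamma>^2. Both signs are kept, since the
  lower side yields observability and the upper side convergence.\<close>

lemma weighted_integral_expsum:
  assumes "T > 0" "\<gamma> > 2 * (pi / T)" "finite F" "separated \<gamma> F"
  shows "\<bar>integral {0..T} (\<lambda>t. sin (pi / T * t) * (cmod (expsum F a t))\<^sup>2)
            - 2 / (pi / T) * (\<Sum>l\<in>F. (cmod (a l))\<^sup>2)\<bar>
         \<le> 8 * (pi / T) / \<gamma>\<^sup>2 * (\<Sum>l\<in>F. (cmod (a l))\<^sup>2)"
proof -
  define w where "w = pi / T"
  have "w > 0" using assms by (simp add: w_def)
  have far: "\<gamma> \<le> \<bar>l - m\<bar>" if "l \<in> F" "m \<in> F" "l \<noteq> m" for l m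
    using assms(4) that by (auto simp: separated_def)
  define K where "K = sine_kernel T"
  have HK: "((\<lambda>t. of_real (sin (w * t)) * cis ((l - m) * t)) has_integral K (l - m)) {0..T}"
    if "l \<in> F" "m \<in> F" for l m
    unfolding K_def w_def
  proof (rule has_integral_sine_kernel[OF assms(1)])
    show "(l - m)\<^sup>2 \<noteq> (pi / T)\<^sup>2"
    proof (cases "l = m")
      case False
      then have "w < \<bar>l - m\<bar>" using far[OF that] assms(2) \<open>w > 0\<close> by (simp add: w_def)
      then have "w\<^sup>2 < \<bar>l - m\<bar>\<^sup>2" using \<open>w > 0\<close> by (intro power_strict_mono) auto
      then show ?thesis by (simp add: w_def)
    qed (use assms in auto)
  qed
  have "((\<lambda>t. \<Sum>l\<in>F. \<Sum>m\<in>F. (a l * cnj (a m)) * (of_real (sin (w * t)) * cis ((l - m) * t)))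
     has_integral (\<Sum>l\<in>F. \<Sum>m\<in>F. (a l * cnj (a m)) * K (l - m))) {0..T}"
    by (intro has_integral_sum assms has_integral_mult_right HK)
  also have "(\<lambda>t. \<Sum>l\<in>F. \<Sum>m\<in>F. (a l * cnj (a m)) * (of_real (sin (w * t)) * cis ((l - m) * t))) =
      (\<lambda>t. of_real (sin (w * t) * (cmod (expsum F a t))\<^sup>2))"
    unfolding of_real_mult norm_square_expsum by (simp add: sum_distrib_left mult_ac)
  finally have I: "((\<lambda>t. complex_of_real (sin (w * t) * (cmod (expsum F a t))\<^sup>2)) has_integral
      (\<Sum>l\<in>F. \<Sum>m\<in>F. (a l * cnj (a m)) * K (l - m))) {0..T}" .
  define I where "I = integral {0..T} (\<lambda>t. sin (w * t) * (cmod (expsum F a t))\<^sup>2)"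
  have "((\<lambda>t. sin (w * t) * (cmod (expsum F a t))\<^sup>2) has_integral I) {0..T}"
    unfolding I_def by (intro integrable_integral integrable_continuous_interval continuous_intros)
  from has_integral_of_real[OF this] I
  have I_eq: "of_real I = (\<Sum>l\<in>F. \<Sum>m\<in>F. (a l * cnj (a m)) * K (l - m))"
    by (rule has_integral_unique)
  also have "\<dots> = (\<Sum>l\<in>F. a l * cnj (a l) * K 0 + (\<Sum>m\<in>F - {l}. (a l * cnj (a m)) * K (l - m)))"
    using assms(3) by (intro sum.cong refl) (simp add: sum.remove)
  also have "\<dots> = of_real (2 / w * (\<Sum>l\<in>F. (cmod (a l))\<^sup>2)) +
      (\<Sum>l\<in>F. \<Sum>m\<in>F - {l}. (a l * cnj (a m)) * K (l - m))"
    unfolding sum.distrib K_def sine_kernel_0[OF assms(1)] w_def[symmetric] of_real_mult of_real_sum complex_norm_square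
    by (simp add: sum_distrib_left mult_ac)
  finally have "of_real (I - 2 / w * (\<Sum>l\<in>F. (cmod (a l))\<^sup>2)) =
      (\<Sum>l\<in>F. \<Sum>m\<in>F - {l}. (a l * cnj (a m)) * K (l - m))"
    by simp
  then have "\<bar>I - 2 / w * (\<Sum>l\<in>F. (cmod (a l))\<^sup>2)\<bar> =
      cmod (\<Sum>l\<in>F. \<Sum>m\<in>F - {l}. (a l * cnj (a m)) * K (l - m))"
    by (metis norm_of_real)
  also have "\<dots> \<le> (\<Sum>l\<in>F. \<Sum>m\<in>F - {l}. ((cmod (a l))\<^sup>2 + (cmod (a m))\<^sup>2) / 2 * (2 * w / ((l - m)\<^sup>2 - w\<^sup>2)))"
  proof (intro sum_norm_le)
    fix l m assume A: "l \<in> F" "m \<in> F - {l}"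
    have "cmod (a l) * cmod (a m) \<le> ((cmod (a l))\<^sup>2 + (cmod (a m))\<^sup>2) / 2"
      using sum_squares_bound[of "cmod (a l)" "cmod (a m)"] by (simp add: field_simps)
    moreover have "cmod (K (l - m)) \<le> 2 * w / ((l - m)\<^sup>2 - w\<^sup>2)"
      unfolding K_def w_def using A by (intro norm_sine_kernel_le[where \<gamma> = \<gamma>] far assms) auto
    ultimately show "cmod (a l * cnj (a m) * K (l - m)) \<le>
        ((cmod (a l))\<^sup>2 + (cmod (a m))\<^sup>2) / 2 * (2 * w / ((l - m)\<^sup>2 - w\<^sup>2))"
      unfolding norm_mult complex_mod_cnj by (intro mult_mono) auto
  qed
  also have "\<dots> = (\<Sum>l\<in>F. \<Sum>m\<in>F - {l}. (cmod (a l))\<^sup>2 * (w / ((l - m)\<^sup>2 - w\<^sup>2)))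
                + (\<Sum>l\<in>F. \<Sum>m\<in>F - {l}. (cmod (a m))\<^sup>2 * (w / ((l - m)\<^sup>2 - w\<^sup>2)))"
    unfolding sum.distrib[symmetric]
    by (intro sum.cong refl) (simp add: add_divide_distrib distrib_right)
  \<comment> \<open>The kernel bound is symmetric in l and m, so exchanging the two sums makes both
    halves equal. The condition m \<noteq> l moves into an \<open>if\<close> first, because
    \<open>F - {l}\<close> depends on the outer index.\<close>
  also have "(\<Sum>l\<in>F. \<Sum>m\<in>F - {l}. (cmod (a m))\<^sup>2 * (w / ((l - m)\<^sup>2 - w\<^sup>2))) =
     (\<Sum>l\<in>F. \<Sum>m\<in>F - {l}. (cmod (a l))\<^sup>2 * (w / ((l - m)\<^sup>2 - w\<^sup>2)))"
  proof -
    have *: "(\<Sum>l\<in>F. \<Sum>m\<in>F - {l}. g l m) = (\<Sum>l\<in>F. \<Sum>m\<in>F. if m = l then 0 else g l m)" for g :: "real \<Rightarrow> real \<Rightarrow> real"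
      using assms(3) by (intro sum.cong refl sum.mono_neutral_cong_left) auto
    show ?thesis
      unfolding * by (subst sum.swap) (intro sum.cong refl, simp add: power2_commute)
  qed
  also have "(\<Sum>l\<in>F. \<Sum>m\<in>F - {l}. (cmod (a l))\<^sup>2 * (w / ((l - m)\<^sup>2 - w\<^sup>2)))
      \<le> (\<Sum>l\<in>F. (cmod (a l))\<^sup>2 * (w * (4 / \<gamma>\<^sup>2)))"
  proof (intro sum_mono)
    fix l assume "l \<in> F"
    then have "(\<Sum>m\<in>F - {l}. 1 / ((l - m)\<^sup>2 - w\<^sup>2)) \<le> 4 / \<gamma>\<^sup>2"
      using assms \<open>w > 0\<close> by (intro sum_separated_le) (auto simp: w_def)
    then have "(cmod (a l))\<^sup>2 * (w * (\<Sum>m\<in>F - {l}. 1 / ((l - m)\<^sup>2 - w\<^sup>2))) \<le> (cmod (a l))\<^sup>2 * (w * (4 / \<gamma>\<^sup>2))"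
      using \<open>w > 0\<close> by (intro mult_left_mono) auto
    then show "(\<Sum>m\<in>F - {l}. (cmod (a l))\<^sup>2 * (w / ((l - m)\<^sup>2 - w\<^sup>2))) \<le> (cmod (a l))\<^sup>2 * (w * (4 / \<gamma>\<^sup>2))"
      by (simp add: sum_distrib_left)
  qed
  also have "(\<Sum>l\<in>F. (cmod (a l))\<^sup>2 * (w * (4 / \<gamma>\<^sup>2))) + (\<Sum>l\<in>F. (cmod (a l))\<^sup>2 * (w * (4 / \<gamma>\<^sup>2)))
      = 8 * w / \<gamma>\<^sup>2 * (\<Sum>l\<in>F. (cmod (a l))\<^sup>2)"
    unfolding sum_distrib_right[symmetric] by simp
  finally show ?thesis
    unfolding I_def w_def by (simp add: algebra_simps)
qed

lemma expsum_lower_bound_separated: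
  assumes "\<gamma> > 0" "T > 2 * pi / \<gamma>" "separated \<gamma> S"
  shows "\<exists>C>0. \<forall>F a. finite F \<longrightarrow> F \<subseteq> S \<longrightarrow>
    (\<Sum>l\<in>F. (cmod (a l))\<^sup>2) \<le> C * integral {0..T} (\<lambda>t. (cmod (expsum F a t))\<^sup>2)"
proof -
  define w where "w = pi / T"
  have "2 * pi / \<gamma> > 0" using assms(1) by simp
  then have T: "T > 0" using assms(2) by linarith
  then have w: "w > 0" "\<gamma> > 2 * w"
    using assms by (auto simp: w_def field_simps)
  \<comment> \<open>Diagonal entry minus row sum; it is positive exactly when 4 w^2 <
    \<gamma>^2.\<close>
  define c where "c = 2 / w - 8 * w / \<gamma>\<^sup>2"
  have "(2 * w)\<^sup>2 < \<gamma>\<^sup>2" using w by (intro power_strict_mono) auto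
  then have c: "c > 0"
    unfolding c_def using w by (simp add: field_simps power2_eq_square)
  show ?thesis
  proof (intro exI[of _ "1 / c"] conjI allI impI)
    fix F and a :: "real \<Rightarrow> complex" assume F: "finite F" "F \<subseteq> S"
    have "c * (\<Sum>l\<in>F. (cmod (a l))\<^sup>2) \<le> integral {0..T} (\<lambda>t. sin (w * t) * (cmod (expsum F a t))\<^sup>2)"
      using weighted_integral_expsum[of T \<gamma> F a] w T F separated_subset[OF assms(3) F(2)]
      unfolding c_def w_def by (simp add: algebra_simps)
    also have "\<dots> \<le> integral {0..T} (\<lambda>t. (cmod (expsum F a t))\<^sup>2)"
    proof (intro integral_le expsum_integrable)
      show "(\<lambda>t. sin (w * t) * (cmod (expsum F a t))\<^sup>2) integrable_on {0..T}"
        by (intro integrable_continuous_interval continuous_intros)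
      show "sin (w * t) * (cmod (expsum F a t))\<^sup>2 \<le> (cmod (expsum F a t))\<^sup>2" for t
        using mult_right_mono[OF sin_le_one[of "w * t"], of "(cmod (expsum F a t))\<^sup>2"] by simp
    qed
    finally show "(\<Sum>l\<in>F. (cmod (a l))\<^sup>2) \<le> 1 / c * integral {0..T} (\<lambda>t. (cmod (expsum F a t))\<^sup>2)"
      using c by (simp add: field_simps)
  qed (use c in auto)
qed

section \<open>The upper bound on intervals of arbitrary length\<close>

lemma expsum_shift: "expsum F a (t + s) = expsum F (\<lambda>l. a l * cis (l * s)) t"
  unfolding expsum_def by (intro sum.cong refl) (simp add: cis_mult algebra_simps)

lemma integral_expsum_shift:
  "integral {s..s + T} (\<lambda>t. (cmod (expsum F a t))\<^sup>2) =
   integral {0..T} (\<lambda>t. (cmod (expsum F a (t + s)))\<^sup>2)"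
  using integral_shift_Icc_real[of 0 T "\<lambda>t. (cmod (expsum F a t))\<^sup>2" s]
  by (simp add: o_def add.commute)

text \<open>On the middle half of a longer interval the sine weight is at least 1/2, so the weighted
  estimate controls the unweighted integral over a window inside that half. Translating the window
  there only changes the phases of the coefficients.\<close>

lemma expsum_upper_bound_separated:
  assumes "\<gamma> > 0" "separated \<gamma> S"
  shows "\<exists>C>0. \<forall>F a. finite F \<longrightarrow> F \<subseteq> S \<longrightarrow>
    integral {0..T} (\<lambda>t. (cmod (expsum F a t))\<^sup>2) \<le> C * (\<Sum>l\<in>F. (cmod (a l))\<^sup>2)"
proof -
  \<comment> \<open>\<open>R \<ge> 2 * T\<close> makes a window of length T fit between R / 4 and 3
    R / 4; \<open>R > 2 * pi / \<gamma>\<close> is what the Gram estimate on [0, R]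
    requires.\<close>
  define R where "R = Max {2 * T, 1, 2 * pi / \<gamma> + 1}"
  have R: "R \<ge> 2 * T" "R \<ge> 1" "R > 2 * pi / \<gamma>"
    unfolding R_def by (auto simp: less_max_iff_disj)
  define w where "w = pi / R"
  have w: "w > 0" "\<gamma> > 2 * w"
    using R assms(1) by (auto simp: w_def field_simps)
  define c where "c = 2 / w + 8 * w / \<gamma>\<^sup>2"
  have "8 * w / \<gamma>\<^sup>2 \<ge> 0" "2 / w > 0" using w by auto
  then have c: "c > 0" unfolding c_def by linarith
  show ?thesis
  proof (intro exI[of _ "2 * c"] conjI allI impI)
    fix F and a :: "real \<Rightarrow> complex" assume F: "finite F" "F \<subseteq> S"
    define s where "s = R / 4"
    define b where "b l = a l * cis (l * (- s))" for l
    have nb: "cmod (b l) = cmod (a l)" for l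
      by (simp add: b_def norm_mult)
    have "expsum F a t = expsum F b (t + s)" for t
      unfolding expsum_shift b_def by (simp add: mult.assoc cis_mult)
    then have "integral {0..T} (\<lambda>t. (cmod (expsum F a t))\<^sup>2) = integral {s..s + T} (\<lambda>t. (cmod (expsum F b t))\<^sup>2)"
      by (simp add: integral_expsum_shift)
    also have "\<dots> \<le> integral {s..s + T} (\<lambda>t. 2 * (sin (w * t) * (cmod (expsum F b t))\<^sup>2))"
    proof (intro integral_le expsum_integrable)
      show "(\<lambda>t. 2 * (sin (w * t) * (cmod (expsum F b t))\<^sup>2)) integrable_on {s..s + T}"
        by (intro integrable_continuous_interval continuous_intros)
      fix t assume t: "t \<in> {s..s + T}"
      have wR: "w * R = pi" using R by (simp add: w_def)
      have "R / 4 \<le> t" "t \<le> 3 * R / 4" using t R by (auto simp: s_def)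
      then have "w * (R / 4) \<le> w * t" "w * t \<le> w * (3 * R / 4)"
        using w by (auto intro: mult_left_mono)
      \<comment> \<open>The window gives pi / 4 and 3 pi / 4; the weaker pi / 6 is taken because its
        sine is the convenient 1/2.\<close>
      then have b: "pi / 6 \<le> w * t" "w * t \<le> 5 * pi / 6"
        using wR pi_gt_zero by linarith+
      have "sin (w * t) \<ge> sin (pi / 6)"
      proof (cases "w * t \<le> pi / 2")
        case True
        then show ?thesis using b pi_gt_zero by (intro sin_monotone_2pi_le) auto
      next
        case False
        then have "sin (pi / 6) \<le> sin (pi - w * t)" using b pi_gt_zero by (intro sin_monotone_2pi_le) auto
        then show ?thesis by simp
      qed
      then have "sin (w * t) \<ge> 1 / 2" by (simp add: sin_30)
      then have "1 * (cmod (expsum F b t))\<^sup>2 \<le> (2 * sin (w * t)) * (cmod (expsum F b t))\<^sup>2"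
        by (intro mult_right_mono) auto
      then show "(cmod (expsum F b t))\<^sup>2 \<le> 2 * (sin (w * t) * (cmod (expsum F b t))\<^sup>2)"
        by simp
    qed
    also have "\<dots> = 2 * integral {s..s + T} (\<lambda>t. sin (w * t) * (cmod (expsum F b t))\<^sup>2)"
      by simp
    also have "\<dots> \<le> 2 * integral {0..R} (\<lambda>t. sin (w * t) * (cmod (expsum F b t))\<^sup>2)"
    proof (intro mult_left_mono integral_subset_le)
      show "\<forall>t\<in>{0..R}. 0 \<le> sin (w * t) * (cmod (expsum F b t))\<^sup>2"
      proof
        fix t assume that: "t \<in> {0..R}"
        have "w * t \<le> w * R" using that w by (intro mult_left_mono) auto
        also have "w * R = pi" using R by (simp add: w_def)
        finally have "0 \<le> sin (w * t)" using that w by (intro sin_ge_zero) auto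
        then show "0 \<le> sin (w * t) * (cmod (expsum F b t))\<^sup>2" by simp
      qed
    qed (use R s_def in \<open>auto intro!: integrable_continuous_interval continuous_intros\<close>)
    also have "\<dots> \<le> 2 * (c * (\<Sum>l\<in>F. (cmod (b l))\<^sup>2))"
      using weighted_integral_expsum[OF _ _ F(1), of R \<gamma> b] w(2) R separated_subset[OF assms(2) F(2)]
      unfolding c_def w_def[symmetric] by (simp add: distrib_right del: times_divide_eq_left times_divide_eq_right)
    finally show "integral {0..T} (\<lambda>t. (cmod (expsum F a t))\<^sup>2) \<le> 2 * c * (\<Sum>l\<in>F. (cmod (a l))\<^sup>2)"
      by (simp add: nb)
  qed (use c in auto)
qed

section \<open>Adding finitely many frequencies\<close>

text \<open>At most one point of S is closer than \<gamma> / 2 to \<mu>, since two would be less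
  than \<gamma> apart; the distance to that point is then the new gap. Its size does not matter
  later: \<delta> enters constants but never the length of the time interval.\<close>

lemma separated_insert:
  assumes "\<gamma> > 0" "separated \<gamma> S" "\<mu> \<notin> S"
  shows "\<exists>\<delta>>0. separated \<delta> (insert \<mu> S)"
proof (cases "\<exists>s\<in>S. \<bar>s - \<mu>\<bar> < \<gamma> / 2")
  case True
  then obtain s where s: "s \<in> S" "\<bar>s - \<mu>\<bar> < \<gamma> / 2" by blast
  then have "\<bar>s - \<mu>\<bar> > 0" using assms(3) by auto
  have "\<bar>s - \<mu>\<bar> \<le> \<bar>x - \<mu>\<bar>" if "x \<in> S" for x
  proof (rule ccontr)
    assume "\<not> ?thesis"
    moreover from this have "\<bar>x - s\<bar> < \<gamma>" using s by linarith
    ultimately have "x \<noteq> s" "\<bar>x - s\<bar> < \<gamma>" by auto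
    then show False using assms(2) s(1) that unfolding separated_def by force
  qed
  moreover have "\<bar>s - \<mu>\<bar> \<le> \<bar>x - y\<bar>" if "x \<in> S" "y \<in> S" "x \<noteq> y" for x y
    using assms(1,2) s(2) that unfolding separated_def by force
  ultimately have "separated \<bar>s - \<mu>\<bar> (insert \<mu> S)"
    unfolding separated_def by (metis abs_minus_commute insertE)
  then show ?thesis using \<open>\<bar>s - \<mu>\<bar> > 0\<close> by blast
next
  case False
  then have "\<gamma> / 2 \<le> \<bar>x - \<mu>\<bar>" if "x \<in> S" for x
    using that by auto
  moreover have "\<gamma> / 2 \<le> \<bar>x - y\<bar>" if "x \<in> S" "y \<in> S" "x \<noteq> y" for x y
    using assms(1,2) that unfolding separated_def by force
  ultimately have "separated (\<gamma> / 2) (insert \<mu> S)"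
    unfolding separated_def by (metis abs_minus_commute insertE)
  then show ?thesis using assms(1) by (intro exI[of _ "\<gamma> / 2"]) simp
qed

lemma separated_Un_finite:
  assumes "finite W" "\<gamma> > 0" "separated \<gamma> S"
  shows "\<exists>\<delta>>0. separated \<delta> (W \<union> S)"
  using assms
proof (induction W)
  case (insert \<mu> W)
  then show ?case
    by (metis Un_insert_left insert_absorb separated_insert)
qed auto

text \<open>A version of sin z < z that is uniform away from 0. It keeps the mean of |1 - e^(i y
  s)|^2 over a range of shifts s bounded below for all |y| \<ge> \<delta>.\<close>

lemma sin_le_mult_less_one:
  assumes "z0 > 0"
  shows "\<exists>\<kappa>>0. \<forall>z\<ge>z0. sin z \<le> (1 - \<kappa>) * (z::real)"
\<comment> \<open>For z \<ge> 2 the bound sin z \<le> 1 \<le> z / 2 gives 1/2. For z < 2 the Taylor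
  bound z - z^3 / 6 + z^5 / 120 with z^2 \<le> 4 leaves 1/6 - 4/120 = 2/15 as the coefficient of -
  z^3.\<close>
proof (intro exI[of _ "min (1 / 2) (2 * z0\<^sup>2 / 15)"] conjI allI impI)
  fix z assume z: "z \<ge> z0"
  show "sin z \<le> (1 - min (1 / 2) (2 * z0\<^sup>2 / 15)) * z"
  proof (cases "z \<ge> 2")
    case True
    then have "sin z \<le> 1 / 2 * z" using sin_le_one[of z] by linarith
    also have "\<dots> \<le> (1 - min (1 / 2) (2 * z0\<^sup>2 / 15)) * z"
      using True by (intro mult_right_mono) auto
    finally show ?thesis .
  next
    case False
    have "\<bar>sin z - (\<Sum>m<5. sin_coeff m * z ^ m)\<bar> \<le> inverse (fact 5) * \<bar>z\<bar> ^ 5"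
      by (rule Maclaurin_sin_bound)
    moreover have "{..<5::nat} = {0, 1, 2, 3, 4}" by auto
    ultimately have "\<bar>sin z - (z - z ^ 3 / 6)\<bar> \<le> z ^ 5 / 120"
      using z assms by (simp add: sin_coeff_def fact_numeral)
    then have "sin z \<le> z - z ^ 3 / 6 + z ^ 5 / 120"
      using abs_le_D1 by fastforce
    also have "\<dots> = z - z ^ 3 / 6 + z ^ 3 * (z\<^sup>2 / 120)"
      by (simp add: power_add[symmetric])
    also have "z ^ 3 * (z\<^sup>2 / 120) \<le> z ^ 3 * (4 / 120)"
      using False z assms power_mono[of z 2 2] by (intro mult_left_mono) auto
    also have "z - z ^ 3 / 6 + z ^ 3 * (4 / 120) = (1 - 2 * z\<^sup>2 / 15) * z"
      by (simp add: power2_eq_square power3_eq_cube algebra_simps)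
    also have "\<dots> \<le> (1 - min (1 / 2) (2 * z0\<^sup>2 / 15)) * z"
    proof (intro mult_right_mono)
      have "z0\<^sup>2 \<le> z\<^sup>2" using z assms by (intro power_mono) auto
      then show "1 - 2 * z\<^sup>2 / 15 \<le> 1 - min (1 / 2) (2 * z0\<^sup>2 / 15)"
        by (auto simp: min_le_iff_disj)
    qed (use z assms in auto)
    finally show ?thesis by simp
  qed
qed (use assms in auto)

lemma norm_one_minus_cis_square: "(cmod (1 - cis x))\<^sup>2 = 2 - 2 * cos x"
  unfolding cmod_power2 using sin_cos_squared_add[of x] by (simp add: power2_eq_square algebra_simps)

text \<open>The lower Riesz bound for the exponentials in L^2(0, T). The constant is chosen before F
  and a, so that the bound survives the passage to infinite series.\<close>

definition bounded_below :: "real \<Rightarrow> real set \<Rightarrow> bool" where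
  "bounded_below T S \<longleftrightarrow> (\<exists>C>0. \<forall>F a. finite F \<longrightarrow> F \<subseteq> S \<longrightarrow>
    (\<Sum>l\<in>F. (cmod (a l))\<^sup>2) \<le> C * integral {0..T} (\<lambda>t. (cmod (expsum F a t))\<^sup>2))"

lemma integral_mono_interval:
  fixes T T' s :: real
  assumes "0 \<le> s" "s + T \<le> T'"
  shows "integral {s..s + T} (\<lambda>t. (cmod (expsum F a t))\<^sup>2) \<le> integral {0..T'} (\<lambda>t. (cmod (expsum F a t))\<^sup>2)"
  using assms by (intro integral_subset_le expsum_integrable) auto

text \<open>
  The operator \<open>f \<mapsto> f - e\<^sup>-\<^sup>i\<^sup>\<mu>\<^sup>s f(\<cdot> + s)\<close> kills the frequency \<open>\<mu>\<close> and multiplies the coefficient at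
  \<open>l\<close> by \<open>1 - e\<^sup>i\<^sup>(\<^sup>l\<^sup>-\<^sup>\<mu>\<^sup>)\<^sup>s\<close>, whose squared modulus is bounded below after averaging over \<open>s\<close>.
\<close>

lemma bounded_below_insert:
  assumes lb: "bounded_below T S" and T: "0 \<le> T" "T < T'"
    and \<delta>: "\<delta> > 0" "separated \<delta> (insert \<mu> S)" and \<mu>: "\<mu> \<notin> S"
  shows "bounded_below T' (insert \<mu> S)"
proof -
  obtain C where C: "C > 0" "\<And>F a. finite F \<Longrightarrow> F \<subseteq> S \<Longrightarrow>
    (\<Sum>l\<in>F. (cmod (a l))\<^sup>2) \<le> C * integral {0..T} (\<lambda>t. (cmod (expsum F a t))\<^sup>2)"
    using lb unfolding bounded_below_def by blast
  have "separated \<delta> S" using \<delta>(2) by (rule separated_subset) auto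
  then obtain D where D: "D > 0" "\<And>F a. finite F \<Longrightarrow> F \<subseteq> S \<Longrightarrow>
    integral {0..T'} (\<lambda>t. (cmod (expsum F a t))\<^sup>2) \<le> D * (\<Sum>l\<in>F. (cmod (a l))\<^sup>2)"
    using expsum_upper_bound_separated[OF \<delta>(1)] by blast
  \<comment> \<open>The admissible shifts: for s between 0 and \<eta> the window from s to s + T
    stays inside [0, T'].\<close>
  define \<eta> where "\<eta> = T' - T"
  have \<eta>: "\<eta> > 0" using T by (simp add: \<eta>_def)
  obtain \<kappa> where \<kappa>: "\<kappa> > 0" "\<And>z. z \<ge> \<delta> * \<eta> \<Longrightarrow> sin z \<le> (1 - \<kappa>) * z"
    using sin_le_mult_less_one[of "\<delta> * \<eta>"] \<delta> \<eta> by auto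
  \<comment> \<open>The right-hand side is the integral of 2 - 2 cos (y s) over s in [0, \<eta>]. A
    single shift would not do, since 1 - e^(i y s) vanishes whenever y s is a multiple of 2
    pi.\<close>
  have far: "2 * \<eta> * \<kappa> \<le> 2 * \<eta> - 2 * (sin (y * \<eta>) / y)" if "\<bar>y\<bar> \<ge> \<delta>" for y
  proof -
    have "\<bar>y\<bar> > 0" using that \<delta> by linarith
    have "sin (\<bar>y\<bar> * \<eta>) \<le> (1 - \<kappa>) * (\<bar>y\<bar> * \<eta>)"
      using that \<eta> by (intro \<kappa>(2) mult_right_mono) auto
    then have "sin (\<bar>y\<bar> * \<eta>) / \<bar>y\<bar> \<le> (1 - \<kappa>) * \<eta>"
      using \<open>\<bar>y\<bar> > 0\<close> by (simp add: pos_divide_le_eq mult_ac)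
    moreover have "sin (\<bar>y\<bar> * \<eta>) / \<bar>y\<bar> = sin (y * \<eta>) / y"
      by (cases "y \<ge> 0") auto
    ultimately show ?thesis by (simp add: algebra_simps)
  qed
  \<comment> \<open>B bounds the coefficients other than that of \<mu>: their sum times 2 \<eta>
    \<kappa> is at most 4 C \<eta> times the integral over [0, T']. E adds the coefficient of \<mu>,
    obtained by subtracting the other terms at the cost of D.\<close>
  define B where "B = 4 * C / (2 * \<kappa>)"
  define E where "E = 2 / T' + (2 * D / T' + 1) * B"
  have B: "B > 0" using C \<kappa> by (simp add: B_def)
  have E: "E > 0" unfolding E_def using T B D by (intro add_pos_pos mult_pos_pos) auto
  have "(\<Sum>l\<in>F. (cmod (a l))\<^sup>2) \<le> E * integral {0..T'} (\<lambda>t. (cmod (expsum F a t))\<^sup>2)"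
    if F: "finite F" "F \<subseteq> insert \<mu> S" for F and a :: "real \<Rightarrow> complex"
  proof -
    define G where "G = F - {\<mu>}"
    have G: "finite G" "G \<subseteq> S" "\<mu> \<notin> G" using F by (auto simp: G_def)
    \<comment> \<open>The value 0 covers the case that \<mu> is not in F.\<close>
    define c where "c = (if \<mu> \<in> F then a \<mu> else 0)"
    have split: "expsum F a t = c * cis (\<mu> * t) + expsum G a t" for t
      using F(1) by (auto simp: expsum_def G_def c_def sum.remove)
    have split2: "(\<Sum>l\<in>F. (cmod (a l))\<^sup>2) = (cmod c)\<^sup>2 + (\<Sum>l\<in>G. (cmod (a l))\<^sup>2)"
      using F(1) by (auto simp: G_def c_def sum.remove)
    define I where "I = integral {0..T'} (\<lambda>t. (cmod (expsum F a t))\<^sup>2)"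
    have step: "(\<Sum>l\<in>G. (cmod (a l))\<^sup>2 * (2 - 2 * cos ((l - \<mu>) * s))) \<le> C * (4 * I)"
      if s: "s \<in> {0..\<eta>}" for s
    proof -
      define b where "b l = a l * (1 - cis ((l - \<mu>) * s))" for l
      have b: "expsum G b t = expsum F a t - cis (- (\<mu> * s)) * expsum F a (t + s)" for t
      proof -
        have "cis (- (\<mu> * s)) * (c * cis (\<mu> * (t + s))) = c * cis (\<mu> * t)"
          by (simp add: cis_mult distrib_left mult.left_commute[of _ c])
        moreover have "expsum G b t = expsum G a t - cis (- (\<mu> * s)) * expsum G a (t + s)"
          unfolding expsum_def sum_distrib_left sum_subtractf[symmetric] b_def
          by (intro sum.cong refl) (simp add: cis_mult algebra_simps)
        ultimately show ?thesis
          unfolding split by (simp only: distrib_left[of "cis (- (\<mu> * s))"]) simp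
      qed
      have "(\<Sum>l\<in>G. (cmod (b l))\<^sup>2) \<le> C * integral {0..T} (\<lambda>t. (cmod (expsum G b t))\<^sup>2)"
        by (rule C(2)[OF G(1,2)])
      also have "integral {0..T} (\<lambda>t. (cmod (expsum G b t))\<^sup>2) \<le>
         integral {0..T} (\<lambda>t. 2 * (cmod (expsum F a t))\<^sup>2 + 2 * (cmod (expsum F a (t + s)))\<^sup>2)"
      proof (intro integral_le expsum_integrable)
        show "(\<lambda>t. 2 * (cmod (expsum F a t))\<^sup>2 + 2 * (cmod (expsum F a (t + s)))\<^sup>2) integrable_on {0..T}"
          unfolding expsum_shift by (intro integrable_continuous_interval continuous_intros)
        show "(cmod (expsum G b t))\<^sup>2 \<le> 2 * (cmod (expsum F a t))\<^sup>2 + 2 * (cmod (expsum F a (t + s)))\<^sup>2" for t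
          unfolding b using norm_diff_square_le[of "expsum F a t" "cis (- (\<mu> * s)) * expsum F a (t + s)"]
          by (simp add: norm_mult)
      qed
      also have "\<dots> = 2 * integral {0..T} (\<lambda>t. (cmod (expsum F a t))\<^sup>2) +
          2 * integral {s..s + T} (\<lambda>t. (cmod (expsum F a t))\<^sup>2)"
        unfolding integral_expsum_shift
        by (subst integral_add) (auto simp: expsum_shift intro!: integrable_continuous_interval continuous_intros)
      also have "\<dots> \<le> 4 * I"
        using integral_mono_interval[of 0 T T' F a] integral_mono_interval[of s T T' F a] s T
        unfolding I_def \<eta>_def by simp
      finally have "(\<Sum>l\<in>G. (cmod (b l))\<^sup>2) \<le> C * (4 * I)"
        using C(1) by simp
      then show ?thesis
        by (simp add: b_def norm_mult power_mult_distrib norm_one_minus_cis_square)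
    qed
    have "2 * \<eta> * \<kappa> * (\<Sum>l\<in>G. (cmod (a l))\<^sup>2) \<le> (\<Sum>l\<in>G. (cmod (a l))\<^sup>2 * (2 * \<eta> - 2 * (sin ((l - \<mu>) * \<eta>) / (l - \<mu>))))"
    proof -
      have "\<delta> \<le> \<bar>l - \<mu>\<bar>" if "l \<in> G" for l
        using \<delta>(2) G that by (auto simp: separated_def)
      then have "(cmod (a l))\<^sup>2 * (2 * \<eta> * \<kappa>) \<le>
          (cmod (a l))\<^sup>2 * (2 * \<eta> - 2 * (sin ((l - \<mu>) * \<eta>) / (l - \<mu>)))" if "l \<in> G" for l
        using that by (intro mult_left_mono far) auto
      then show ?thesis
        unfolding sum_distrib_left mult.commute[of "2 * \<eta> * \<kappa>"] by (intro sum_mono)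
    qed
    also have "\<dots> \<le> C * (4 * I) * \<eta>"
    proof (rule has_integral_le)
      show "((\<lambda>s. \<Sum>l\<in>G. (cmod (a l))\<^sup>2 * (2 - 2 * cos ((l - \<mu>) * s))) has_integral
          (\<Sum>l\<in>G. (cmod (a l))\<^sup>2 * (2 * \<eta> - 2 * (sin ((l - \<mu>) * \<eta>) / (l - \<mu>))))) {0..\<eta>}"
      proof (intro has_integral_sum has_integral_mult_right G)
        fix l assume "l \<in> G"
        then have "l - \<mu> \<noteq> 0" using G by auto
        have "((\<lambda>s. 2 - 2 * cos ((l - \<mu>) * s)) has_integral
           (2 * \<eta> - 2 * (sin ((l - \<mu>) * \<eta>) / (l - \<mu>))) - (2 * 0 - 2 * (sin ((l - \<mu>) * 0) / (l - \<mu>)))) {0..\<eta>}"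
          using \<eta> \<open>l - \<mu> \<noteq> 0\<close>
          by (intro fundamental_theorem_of_calculus)
             (auto intro!: derivative_eq_intros simp: has_real_derivative_iff_has_vector_derivative[symmetric])
        then show "((\<lambda>s. 2 - 2 * cos ((l - \<mu>) * s)) has_integral
           (2 * \<eta> - 2 * (sin ((l - \<mu>) * \<eta>) / (l - \<mu>)))) {0..\<eta>}"
          by simp
      qed
      show "((\<lambda>s. C * (4 * I)) has_integral C * (4 * I) * \<eta>) {0..\<eta>}"
        using has_integral_const_real[of "C * (4 * I)" 0 \<eta>] \<eta> by (simp add: mult_ac)
    qed (use step in auto)
    finally have sG: "(\<Sum>l\<in>G. (cmod (a l))\<^sup>2) \<le> B * I"
      using \<eta> \<kappa> by (simp add: B_def field_simps)
    \<comment> \<open>The \<mu>-term has constant modulus, so its coefficient is the mean of |f -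
      g|^2 over [0, T']. The other terms g are controlled by the upper bound D on all of
      [0, T'].\<close>
    have "T' * (cmod c)\<^sup>2 = integral {0..T'} (\<lambda>t. (cmod (expsum F a t - expsum G a t))\<^sup>2)"
      using T by (simp add: split norm_mult)
    also have "\<dots> \<le> integral {0..T'} (\<lambda>t. 2 * (cmod (expsum F a t))\<^sup>2 + 2 * (cmod (expsum G a t))\<^sup>2)"
      by (intro integral_le norm_diff_square_le integrable_continuous_interval continuous_intros)
    also have "\<dots> = 2 * I + 2 * integral {0..T'} (\<lambda>t. (cmod (expsum G a t))\<^sup>2)"
      unfolding I_def
      by (subst integral_add) (auto intro!: integrable_continuous_interval continuous_intros)
    also have "\<dots> \<le> 2 * I + 2 * (D * (B * I))"
      using order_trans[OF D(2)[OF G(1,2), of a] mult_left_mono[OF sG]] D(1) by simp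
    finally have "(cmod c)\<^sup>2 \<le> (2 * I + 2 * (D * (B * I))) / T'"
      using T by (simp add: pos_le_divide_eq mult.commute)
    then have "(\<Sum>l\<in>F. (cmod (a l))\<^sup>2) \<le> (2 * I + 2 * (D * (B * I))) / T' + B * I"
      unfolding split2 using sG by linarith
    also have "\<dots> = E * I"
      unfolding E_def by (simp add: add_divide_distrib algebra_simps)
    finally show ?thesis unfolding I_def .
  qed
  then show ?thesis
    unfolding bounded_below_def using E by blast
qed

text \<open>Each insertion lengthens the interval strictly, but by as little as desired: a time T0
  strictly between 2 pi / \<gamma> and T is given to the induction hypothesis, which is why T is
  generalised. The empty case is Ingham's inequality.\<close>

lemma bounded_below_Un_finite:
  assumes "finite W" "\<gamma> > 0" "separated \<gamma> S" "T > 2 * pi / \<gamma>"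
  shows "bounded_below T (W \<union> S)"
  using assms(1,4)
proof (induction W arbitrary: T)
  case empty
  then show ?case
    using expsum_lower_bound_separated[OF assms(2) _ assms(3), of T] by (simp add: bounded_below_def)
next
  case (insert \<mu> W)
  show ?case
  proof (cases "\<mu> \<in> W \<union> S")
    case True
    then show ?thesis using insert by (metis Un_insert_left insert_absorb)
  next
    case False
    obtain T0 where T0: "2 * pi / \<gamma> < T0" "T0 < T" using dense insert.prems by blast
    moreover have "0 < 2 * pi / \<gamma>" using assms(2) by simp
    ultimately have "0 \<le> T0" by linarith
    obtain \<delta> where "\<delta> > 0" "separated \<delta> (insert \<mu> W \<union> S)"
      using separated_Un_finite[of "insert \<mu> W"] insert.hyps assms by blast
    then show ?thesis
      using bounded_below_insert[OF insert.IH[OF T0(1)] \<open>0 \<le> T0\<close> T0(2)] False by simp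
  qed
qed

section \<open>Parseval's identity on the circle\<close>

definition square_integrable :: "'a measure \<Rightarrow> ('a \<Rightarrow> complex) \<Rightarrow> bool" where
  "square_integrable M f \<longleftrightarrow> f \<in> borel_measurable M \<and> integrable M (\<lambda>x. (cmod (f x))\<^sup>2)"

lemma square_integrable_bound:
  assumes "f \<in> borel_measurable M" "integrable M w" "\<And>x. (cmod (f x))\<^sup>2 \<le> w x"
  shows "square_integrable M f"
  unfolding square_integrable_def
proof (intro conjI Bochner_Integration.integrable_bound[OF assms(2)])
  show "(\<lambda>x. (cmod (f x))\<^sup>2) \<in> borel_measurable M"
    using assms(1) by measurable
  show "AE x in M. norm ((cmod (f x))\<^sup>2) \<le> norm (w x)"
    using assms(3) by (intro AE_I2) (auto intro: order_trans[OF _ abs_ge_self])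
qed (use assms in auto)

lemma square_integrable_diff:
  assumes "square_integrable M f" "square_integrable M g"
  shows "square_integrable M (\<lambda>x. f x - g x)"
  using assms by (intro square_integrable_bound[where w = "\<lambda>x. 2 * (cmod (f x))\<^sup>2 + 2 * (cmod (g x))\<^sup>2"])
    (auto simp: square_integrable_def norm_diff_square_le)

lemma square_integrable_mult_cnj:
  assumes "square_integrable M f" "square_integrable M g"
  shows "integrable M (\<lambda>x. f x * cnj (g x))"
proof (rule Bochner_Integration.integrable_bound)
  show "integrable M (\<lambda>x. (cmod (f x))\<^sup>2 + (cmod (g x))\<^sup>2)"
    using assms by (auto simp: square_integrable_def)
  show "(\<lambda>x. f x * cnj (g x)) \<in> borel_measurable M"
    using assms unfolding square_integrable_def
    by (intro borel_measurable_times measurable_compose[of g M borel cnj] borel_measurable_continuous_onI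
        continuous_intros) auto
  show "AE x in M. norm (f x * cnj (g x)) \<le> norm ((cmod (f x))\<^sup>2 + (cmod (g x))\<^sup>2)"
  proof (rule AE_I2)
    fix x
    have "2 * (cmod (f x) * cmod (g x)) \<le> (cmod (f x))\<^sup>2 + (cmod (g x))\<^sup>2"
      using sum_squares_bound[of "cmod (f x)" "cmod (g x)"] by simp
    moreover have "0 \<le> cmod (f x) * cmod (g x)" by (rule mult_nonneg_nonneg) auto
    ultimately have "cmod (f x) * cmod (g x) \<le> (cmod (f x))\<^sup>2 + (cmod (g x))\<^sup>2"
      by linarith
    then show "norm (f x * cnj (g x)) \<le> norm ((cmod (f x))\<^sup>2 + (cmod (g x))\<^sup>2)"
      by (simp add: norm_mult)
  qed
qed

text \<open>A substitute for the triangle inequality in L^2 that stays with squared norms; the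
  factor 2 is harmless in every use.\<close>

lemma integral_norm_diff_square_le:
  assumes "square_integrable M f" "square_integrable M g" "square_integrable M h"
  shows "(LINT x|M. (cmod (f x - h x))\<^sup>2) \<le>
    2 * (LINT x|M. (cmod (f x - g x))\<^sup>2) + 2 * (LINT x|M. (cmod (g x - h x))\<^sup>2)"
proof -
  have i: "integrable M (\<lambda>x. (cmod (f x - g x))\<^sup>2)" "integrable M (\<lambda>x. (cmod (g x - h x))\<^sup>2)"
    "integrable M (\<lambda>x. (cmod (f x - h x))\<^sup>2)"
    using square_integrable_diff assms unfolding square_integrable_def by blast+
  have "(LINT x|M. (cmod (f x - h x))\<^sup>2) \<le> (LINT x|M. 2 * (cmod (f x - g x))\<^sup>2 + 2 * (cmod (g x - h x))\<^sup>2)"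
  proof (intro integral_mono)
    show "(cmod (f x - h x))\<^sup>2 \<le> 2 * (cmod (f x - g x))\<^sup>2 + 2 * (cmod (g x - h x))\<^sup>2" for x
      using norm_sum_square_le[of "f x - g x" "g x - h x"] by simp
  qed (use i in auto)
  then show ?thesis using i by simp
qed

lemma square_integrable_continuous:
  fixes f :: "real \<Rightarrow> complex"
  assumes "continuous_on {a..b} f"
  shows "square_integrable (lebesgue_on {a..b}) f"
  unfolding square_integrable_def
  using assms by (auto intro!: continuous_imp_integrable_real continuous_imp_measurable_on_sets_lebesgue continuous_intros)

lemma set_lebesgue_integral_lebesgue_on:
  fixes f :: "real \<Rightarrow> 'a::{banach, second_countable_topology}"
  shows "(LINT x:{a..b}|lebesgue. f x) = integral\<^sup>L (lebesgue_on {a..b}) f"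
  by (simp add: set_lebesgue_integral_def integral_restrict_space)

lemma set_integrable_lebesgue_on:
  fixes f :: "real \<Rightarrow> 'a::{banach, second_countable_topology}"
  shows "set_integrable lebesgue {a..b} f = integrable (lebesgue_on {a..b}) f"
  by (simp add: set_integrable_def integrable_restrict_space)

lemma L2_circle_square_integrable:
  "u \<in> L2_circle \<Longrightarrow> square_integrable (lebesgue_on {0..2 * pi}) u"
  by (auto simp: L2_circle_def square_integrable_def set_integrable_lebesgue_on intro: measurable_restrict_space1)

section \<open>Density of trigonometric polynomials in L^2 of the circle\<close>

definition trig_poly :: "(real \<Rightarrow> complex) \<Rightarrow> bool" where
  "trig_poly q \<longleftrightarrow> (\<exists>F b. finite F \<and> q = (\<lambda>x. \<Sum>k\<in>F. b k * cis (of_int k * x)))"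

lemma trig_poly_single: "trig_poly (\<lambda>x. c * cis (of_int k * x))"
  unfolding trig_poly_def by (intro exI[of _ "{k}"] exI[of _ "\<lambda>_. c"]) simp

lemma trig_poly_const: "trig_poly (\<lambda>x. c)"
  using trig_poly_single[of c 0] by simp

lemma trig_poly_add:
  assumes "trig_poly f" "trig_poly g" shows "trig_poly (\<lambda>x. f x + g x)"
proof -
  obtain F b G d where *: "finite F" "finite G"
    "f = (\<lambda>x. \<Sum>k\<in>F. b k * cis (of_int k * x))" "g = (\<lambda>x. \<Sum>k\<in>G. d k * cis (of_int k * x))"
    using assms unfolding trig_poly_def by blast
  have "(\<Sum>k\<in>F. b k * cis (of_int k * x)) = (\<Sum>k\<in>F \<union> G. (if k \<in> F then b k else 0) * cis (of_int k * x))" for x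
    using * by (intro sum.mono_neutral_cong_left) auto
  moreover have "(\<Sum>k\<in>G. d k * cis (of_int k * x)) = (\<Sum>k\<in>F \<union> G. (if k \<in> G then d k else 0) * cis (of_int k * x))" for x
    using * by (intro sum.mono_neutral_cong_left) auto
  ultimately have "(\<lambda>x. f x + g x) =
      (\<lambda>x. \<Sum>k\<in>F \<union> G. ((if k \<in> F then b k else 0) + (if k \<in> G then d k else 0)) * cis (of_int k * x))"
    unfolding * by (simp add: sum.distrib distrib_right)
  then show ?thesis
    unfolding trig_poly_def using *(1,2) by (intro exI[of _ "F \<union> G"] exI) auto
qed

lemma trig_poly_sum:
  "finite A \<Longrightarrow> (\<And>i. i \<in> A \<Longrightarrow> trig_poly (f i)) \<Longrightarrow> trig_poly (\<lambda>x. \<Sum>i\<in>A. f i x)"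
  by (induction A rule: finite_induct) (auto intro: trig_poly_add trig_poly_const)

lemma trig_poly_mult:
  assumes "trig_poly f" "trig_poly g" shows "trig_poly (\<lambda>x. f x * g x)"
proof -
  obtain F b G d where *: "finite F" "finite G"
    "f = (\<lambda>x. \<Sum>k\<in>F. b k * cis (of_int k * x))" "g = (\<lambda>x. \<Sum>k\<in>G. d k * cis (of_int k * x))"
    using assms unfolding trig_poly_def by blast
  have "(\<lambda>x. f x * g x) = (\<lambda>x. \<Sum>k\<in>F. \<Sum>l\<in>G. (b k * d l) * cis (of_int (k + l) * x))"
    unfolding * sum_product by (auto intro!: sum.cong simp: cis_mult[symmetric] distrib_right)
  then show ?thesis
    using *(1,2) by (simp only: trig_poly_sum trig_poly_single)
qed

text \<open>A real-linear functional on the plane is determined by its values at 1 and \<i>, so on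
  the circle it is a combination of cos x and sin x, hence of cis x and cis (-x). Sums and products
  preserve the form.\<close>

lemma trig_poly_real_polynomial_function:
  fixes f :: "complex \<Rightarrow> real"
  assumes "real_polynomial_function f"
  shows "trig_poly (\<lambda>x. of_real (f (cis x)))"
  using assms
proof (induction f)
  case (linear f)
  then interpret bounded_linear f .
  have "f (cis x) = cos x * f 1 + sin x * f \<i>" for x
  proof -
    have "cis x = cos x *\<^sub>R 1 + sin x *\<^sub>R \<i>" by (simp add: complex_eq_iff)
    then show ?thesis by (simp only: add scaleR) simp
  qed
  moreover have "complex_of_real (cos x) = (1/2) * cis (of_int 1 * x) + (1/2) * cis (of_int (-1) * x)"
    and "complex_of_real (sin x) = (1/(2*\<i>)) * cis (of_int 1 * x) + (-1/(2*\<i>)) * cis (of_int (-1) * x)" for x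
    by (simp_all add: complex_eq_iff)
  ultimately have "(\<lambda>x. complex_of_real (f (cis x))) =
     (\<lambda>x. ((1/2) * cis (of_int 1 * x) + (1/2) * cis (of_int (-1) * x)) * of_real (f 1) +
       ((1/(2*\<i>)) * cis (of_int 1 * x) + (-1/(2*\<i>)) * cis (of_int (-1) * x)) * of_real (f \<i>))"
    by (simp only: of_real_add of_real_mult)
  then show ?case
    by (simp only: trig_poly_add trig_poly_mult trig_poly_single trig_poly_const)
qed (simp_all add: trig_poly_const trig_poly_add trig_poly_mult)

lemma trig_poly_polynomial_function:
  fixes f :: "complex \<Rightarrow> complex"
  assumes "polynomial_function f"
  shows "trig_poly (\<lambda>x. f (cis x))"
proof -
  have "real_polynomial_function (\<lambda>x. Re (f x))" "real_polynomial_function (\<lambda>x. Im (f x))"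
    using assms unfolding polynomial_function_def
    by (auto simp: o_def dest: spec[of _ Re] spec[of _ Im] intro: bounded_linear_Re bounded_linear_Im)
  then have "trig_poly (\<lambda>x. of_real (Re (f (cis x))) + \<i> * of_real (Im (f (cis x))))"
    by (intro trig_poly_add trig_poly_mult trig_poly_const trig_poly_real_polynomial_function)
  then show ?thesis
    by (simp add: complex_eq[symmetric])
qed

lemma continuous_on_trig_poly: "trig_poly q \<Longrightarrow> continuous_on A q"
  by (auto simp: trig_poly_def intro!: continuous_intros)

text \<open>Equal end values make h a continuous function on the unit circle, where
  Stone-Weierstrass gives a polynomial in the real coordinates.\<close>

lemma trig_poly_uniform_approx:
  fixes h :: "real \<Rightarrow> complex"
  assumes "continuous_on {0..2 * pi} h" "h 0 = h (2 * pi)" "\<epsilon> > 0"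
  obtains q where "trig_poly q" "\<And>x. x \<in> {0..2 * pi} \<Longrightarrow> cmod (h x - q x) < \<epsilon>"
proof -
  define p where "p s = h (2 * pi * s)" for s
  have "continuous_on {0..1} p"
    unfolding p_def by (rule continuous_on_compose2[OF assms(1)]) (auto intro!: continuous_intros)
  then have "path p" by (simp add: path_def)
  \<comment> \<open>The only use of homotopy is continuity across the cut at z = 1, where
    \<open>Arg2pi\<close> jumps: a loop is homotopic to itself, hence so is the circle map it
    induces, and maps related by a homotopy are continuous.\<close>
  then have "homotopic_loops UNIV p p"
    using assms(2) by (auto simp: homotopic_loops_refl p_def pathfinish_def pathstart_def)
  then have "homotopic_with_canon (\<lambda>h. True) (sphere 0 1) UNIV
      (p \<circ> (\<lambda>z. Arg2pi z / (2 * pi))) (p \<circ> (\<lambda>z. Arg2pi z / (2 * pi)))"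
    by (rule homotopic_loops_imp_homotopic_circlemaps)
  then have "continuous_on (sphere 0 1) (p \<circ> (\<lambda>z. Arg2pi z / (2 * pi)))"
    using homotopic_with_imp_continuous by blast
  also have "p \<circ> (\<lambda>z. Arg2pi z / (2 * pi)) = (\<lambda>z. h (Arg2pi z))"
    by (auto simp: p_def)
  finally have "continuous_on (sphere 0 1) (\<lambda>z. h (Arg2pi z))" .
  from Stone_Weierstrass_polynomial_function[OF compact_sphere this assms(3)]
  obtain P where P: "polynomial_function P"
    "\<And>z. z \<in> sphere 0 1 \<Longrightarrow> cmod (h (Arg2pi z) - P z) < \<epsilon>"
    by metis
  show ?thesis
  proof
    show "trig_poly (\<lambda>x. P (cis x))" by (rule trig_poly_polynomial_function[OF P(1)])
    fix x assume x: "x \<in> {0..2 * pi}"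
    \<comment> \<open>At x = 2 pi the angle returned is 0, and the equality of the end values is
      used.\<close>
    have "h (Arg2pi (cis x)) = h x"
    proof (cases "x = 2 * pi")
      case True
      then show ?thesis using assms(2) Arg2pi_of_real[of 1] by simp
    next
      case False
      then have "Arg2pi (cis x) = x"
        using x by (intro Arg2pi_unique[of 1]) (auto simp: cis_conv_exp)
      then show ?thesis by simp
    qed
    then show "cmod (h x - P (cis x)) < \<epsilon>" using P(2)[of "cis x"] by simp
  qed
qed

text \<open>A measurable function is an almost everywhere limit of continuous ones. These are
  modified so that uniform approximation applies (equal end values) and so that dominated
  convergence applies (bound B).\<close>

lemma trig_poly_L2_approx_bounded:
  assumes u: "u \<in> borel_measurable (lebesgue_on {0..2 * pi})" "\<And>x. cmod (u x) \<le> B" and "\<epsilon> > 0"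
  obtains q where "trig_poly q" "(LINT x|lebesgue_on {0..2 * pi}. (cmod (u x - q x))\<^sup>2) < \<epsilon>"
proof -
  let ?M = "lebesgue_on {0..2 * pi}"
  have "B \<ge> 0" using norm_ge_zero[of "u 0"] u(2)[of 0] by linarith
  have "u measurable_on {0..2 * pi}"
    using u(1) by (simp add: measurable_on_iff_borel_measurable)
  then obtain N g where N: "negligible N" and g: "\<And>n. continuous_on UNIV (g n)"
    "\<And>x. x \<notin> N \<Longrightarrow> (\<lambda>n. g n x) \<longlonglongrightarrow> (if x \<in> {0..2 * pi} then u x else 0)"
    unfolding measurable_on_def by blast
  \<comment> \<open>A cut-off that vanishes at 0 and 2 pi and equals 1 at distance at least 1 / n
    from both. The two end points are lost for the limit, but they form a null set.\<close>
  define \<phi> where "\<phi> n x = min 1 (real n * min x (2 * pi - x))" for n x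
  \<comment> \<open>The nearest-point map onto the ball of radius B is continuous, enforces the
    bound and fixes the values of u.\<close>
  define cl where "cl = closest_point (cball (0::complex) B)"
  define h where "h n x = of_real (\<phi> n x) * cl (g n x)" for n x
  have contcl: "continuous_on UNIV cl"
    unfolding cl_def using \<open>B \<ge> 0\<close> by (intro continuous_on_closest_point) auto
  have cl: "cmod (cl z) \<le> B" for z
    using closest_point_in_set[of "cball (0::complex) B" z] \<open>B \<ge> 0\<close> by (auto simp: cl_def)
  have conth: "continuous_on {0..2 * pi} (h n)" for n
    unfolding h_def \<phi>_def
    by (intro continuous_intros continuous_on_compose2[OF contcl] continuous_on_subset[OF g(1)]) auto
  have \<phi>: "0 \<le> \<phi> n x" "\<phi> n x \<le> 1" if "x \<in> {0..2 * pi}" for n x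
    using that by (auto simp: \<phi>_def min_def)
  have bh: "cmod (h n x) \<le> B" if "x \<in> {0..2 * pi}" for n x
  proof -
    have "\<phi> n x * cmod (cl (g n x)) \<le> 1 * B"
      using \<phi>[OF that] cl \<open>B \<ge> 0\<close> by (intro mult_mono) auto
    then show ?thesis using \<phi>[OF that] by (simp add: h_def norm_mult)
  qed
  have lim: "(\<lambda>n. h n x) \<longlonglongrightarrow> u x" if "x \<in> {0<..<2 * pi}" "x \<notin> N" for x
  proof -
    define m where "m = min x (2 * pi - x)"
    have "m > 0" using that by (simp add: m_def)
    obtain n0 where "1 / m < real n0" using reals_Archimedean2 by blast
    then have "1 \<le> real n * m" if "n \<ge> n0" for n
    proof -
      have "1 < real n0 * m" using \<open>1 / m < real n0\<close> \<open>m > 0\<close> by (simp add: field_simps)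
      also have "\<dots> \<le> real n * m" using that \<open>m > 0\<close> by (intro mult_right_mono) auto
      finally show ?thesis by simp
    qed
    then have "eventually (\<lambda>n. \<phi> n x = 1) sequentially"
      unfolding \<phi>_def m_def[symmetric] eventually_sequentially by (intro exI[of _ n0]) (auto simp: min_def)
    then have "eventually (\<lambda>n. h n x = cl (g n x)) sequentially"
      by eventually_elim (simp add: h_def)
    moreover have "(\<lambda>n. cl (g n x)) \<longlonglongrightarrow> cl (u x)"
      using g(2)[OF that(2)] that(1) contcl
      by (intro isCont_tendsto_compose[of _ cl]) (auto simp: continuous_on_eq_continuous_at)
    moreover have "cl (u x) = u x"
      unfolding cl_def using u(2) by (intro closest_point_self) simp
    ultimately show ?thesis
      using tendsto_cong by fastforce
  qed
  have sq: "square_integrable ?M u" "square_integrable ?M (h n)" for n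
  proof -
    show "square_integrable ?M (h n)" by (rule square_integrable_continuous[OF conth])
    show "square_integrable ?M u"
      using u by (intro square_integrable_bound[where w = "\<lambda>_. B\<^sup>2"] power_mono) auto
  qed
  have "(\<lambda>n. LINT x|?M. (cmod (u x - h n x))\<^sup>2) \<longlonglongrightarrow> (LINT x|?M. 0)"
  proof (rule integral_dominated_convergence[where w = "\<lambda>_. (2 * B)\<^sup>2"])
    show "(\<lambda>x. (cmod (u x - h n x))\<^sup>2) \<in> borel_measurable ?M" for n
      using square_integrable_diff[OF sq(1) sq(2)[of n]]
      by (simp add: square_integrable_def borel_measurable_integrable)
    have "AE x in lebesgue. x \<notin> N \<union> {0, 2 * pi}"
      using N by (intro AE_not_in) (auto simp: negligible_iff_null_sets[symmetric] negligible_insert)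
    then have "AE x in ?M. x \<in> {0<..<2 * pi} \<and> x \<notin> N"
      unfolding AE_restrict_space_iff[of "{0..2 * pi}" lebesgue, simplified] by eventually_elim auto
    then show "AE x in ?M. (\<lambda>n. (cmod (u x - h n x))\<^sup>2) \<longlonglongrightarrow> 0"
    proof eventually_elim
      case (elim x)
      then have "(\<lambda>n. (cmod (u x - h n x))\<^sup>2) \<longlonglongrightarrow> (cmod (u x - u x))\<^sup>2"
        by (intro tendsto_intros lim) auto
      then show ?case by simp
    qed
    show "AE x in ?M. norm ((cmod (u x - h n x))\<^sup>2) \<le> (2 * B)\<^sup>2" for n
    proof (rule AE_I2)
      fix x assume "x \<in> space ?M"
      then have "cmod (u x - h n x) \<le> B + B"
        by (intro order_trans[OF norm_triangle_ineq4] add_mono u bh) (simp add: space_restrict_space)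
      then have "(cmod (u x - h n x))\<^sup>2 \<le> (B + B)\<^sup>2"
        by (rule power_mono) simp
      then show "norm ((cmod (u x - h n x))\<^sup>2) \<le> (2 * B)\<^sup>2"
        by simp
    qed
  qed auto
  then have "eventually (\<lambda>n. (LINT x|?M. (cmod (u x - h n x))\<^sup>2) < \<epsilon> / 4) sequentially"
    using assms(3) by (intro order_tendstoD[where y = 0]) auto
  then obtain n0 where n0: "\<And>n. n \<ge> n0 \<Longrightarrow> (LINT x|?M. (cmod (u x - h n x))\<^sup>2) < \<epsilon> / 4"
    unfolding eventually_sequentially by blast
  \<comment> \<open>Over the length 2 pi the error \<delta>^2 integrates to \<epsilon> / 8, and 2
    (\<epsilon> / 4) + 2 (\<epsilon> / 8) < \<epsilon>.\<close>
  define \<delta> where "\<delta> = sqrt (\<epsilon> / (16 * pi))"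
  have \<delta>: "\<delta> > 0" "\<delta>\<^sup>2 = \<epsilon> / (16 * pi)" using assms(3) by (auto simp: \<delta>_def)
  obtain q where q: "trig_poly q" "\<And>x. x \<in> {0..2 * pi} \<Longrightarrow> cmod (h n0 x - q x) < \<delta>"
    using trig_poly_uniform_approx[OF conth[of n0] _ \<delta>(1)] by (auto simp: h_def \<phi>_def)
  have sq_q: "square_integrable ?M q"
    using q(1) by (intro square_integrable_continuous continuous_on_trig_poly)
  have "(LINT x|?M. (cmod (h n0 x - q x))\<^sup>2) \<le> (LINT x|?M. \<delta>\<^sup>2)"
  proof (rule integral_mono)
    show "integrable ?M (\<lambda>x. (cmod (h n0 x - q x))\<^sup>2)"
      using square_integrable_diff[OF sq(2) sq_q] by (simp add: square_integrable_def)
    fix x assume "x \<in> space ?M"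
    then show "(cmod (h n0 x - q x))\<^sup>2 \<le> \<delta>\<^sup>2"
      using q(2) by (intro power_mono) (auto simp: space_restrict_space less_imp_le)
  qed auto
  also have "\<dots> = \<epsilon> / 8" by (simp add: \<delta>(2) measure_restrict_space)
  finally have "2 * (LINT x|?M. (cmod (u x - h n0 x))\<^sup>2) + 2 * (LINT x|?M. (cmod (h n0 x - q x))\<^sup>2) < \<epsilon>"
    using n0[of n0] assms(3) by simp
  then show ?thesis
    using that[OF q(1)] integral_norm_diff_square_le[OF sq(1) sq(2)[of n0] sq_q] by simp
qed

text \<open>Reduction to the bounded case: u set to 0 where its modulus exceeds n converges to u in
  L^2, dominated by |u|^2.\<close>

lemma trig_poly_L2_approx:
  assumes u: "square_integrable (lebesgue_on {0..2 * pi}) u" and "\<epsilon> > 0"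
  obtains q where "trig_poly q" "(LINT x|lebesgue_on {0..2 * pi}. (cmod (u x - q x))\<^sup>2) < \<epsilon>"
proof -
  let ?M = "lebesgue_on {0..2 * pi}"
  define w where "w n x = (if cmod (u x) \<le> real n then u x else 0)" for n x
  have m: "u \<in> borel_measurable ?M" using u by (simp add: square_integrable_def)
  have mw: "w n \<in> borel_measurable ?M" for n
    unfolding w_def using m by measurable
  have sqw: "square_integrable ?M (w n)" for n
    using u by (intro square_integrable_bound[where w = "\<lambda>x. (cmod (u x))\<^sup>2"] mw)
      (auto simp: w_def square_integrable_def)
  have "(\<lambda>n. LINT x|?M. (cmod (u x - w n x))\<^sup>2) \<longlonglongrightarrow> (LINT x|?M. 0)"
  proof (rule integral_dominated_convergence[where w = "\<lambda>x. (cmod (u x))\<^sup>2"])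
    show "(\<lambda>x. (cmod (u x - w n x))\<^sup>2) \<in> borel_measurable ?M" for n
      using square_integrable_diff[OF u sqw[of n]]
      by (simp add: square_integrable_def borel_measurable_integrable)
    show "AE x in ?M. (\<lambda>n. (cmod (u x - w n x))\<^sup>2) \<longlonglongrightarrow> 0"
    proof (rule AE_I2)
      fix x
      obtain n0 where "cmod (u x) < real n0" using reals_Archimedean2 by blast
      then have "eventually (\<lambda>n. (cmod (u x - w n x))\<^sup>2 = 0) sequentially"
        unfolding eventually_sequentially by (intro exI[of _ n0]) (auto simp: w_def)
      then show "(\<lambda>n. (cmod (u x - w n x))\<^sup>2) \<longlonglongrightarrow> 0"
        by (rule tendsto_eventually)
    qed
  qed (use u in \<open>auto simp: square_integrable_def w_def\<close>)
  then have "eventually (\<lambda>n. (LINT x|?M. (cmod (u x - w n x))\<^sup>2) < \<epsilon> / 4) sequentially"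
    using assms(2) by (intro order_tendstoD[where y = 0]) auto
  then obtain n0 where n0: "\<And>n. n \<ge> n0 \<Longrightarrow> (LINT x|?M. (cmod (u x - w n x))\<^sup>2) < \<epsilon> / 4"
    unfolding eventually_sequentially by blast
  obtain q where q: "trig_poly q" "(LINT x|?M. (cmod (w n0 x - q x))\<^sup>2) < \<epsilon> / 4"
  proof (rule trig_poly_L2_approx_bounded[OF mw[of n0], of "real n0" "\<epsilon> / 4"])
    show "cmod (w n0 x) \<le> real n0" for x by (simp add: w_def)
  qed (use assms(2) in auto)
  have "2 * (LINT x|?M. (cmod (u x - w n0 x))\<^sup>2) + 2 * (LINT x|?M. (cmod (w n0 x - q x))\<^sup>2) < \<epsilon>"
    using n0[of n0] q(2) by simp
  then show ?thesis
    using that[OF q(1)] integral_norm_diff_square_le[OF u sqw[of n0], of q]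
      square_integrable_continuous[OF continuous_on_trig_poly[OF q(1)]] by fastforce
qed


section \<open>Orthogonality of the exponentials, Bessel and Parseval\<close>

lemma integral_cis_of_int:
  "(LINT x|lebesgue_on {0..2 * pi}. cis (of_int n * x)) = (if n = 0 then of_real (2 * pi) else 0)"
proof (cases "n = 0")
  case True
  then show ?thesis by (simp add: measure_restrict_space scaleR_conv_of_real)
next
  case False
  have "((\<lambda>x. cis (of_int n * x)) has_integral
      cis (of_int n * (2 * pi)) / (\<i> * of_int n) - cis (of_int n * 0) / (\<i> * of_int n)) {0..2 * pi}"
  proof (rule fundamental_theorem_of_calculus)
    show "((\<lambda>x. cis (of_int n * x) / (\<i> * of_int n)) has_vector_derivative cis (of_int n * x))
      (at x within {0..2 * pi})" for x
      using has_vector_derivative_divide[OF cis_has_vector_derivative[of "of_int n"], of "\<i> * of_int n"] False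
      by simp
  qed simp
  moreover have "cis (of_int n * (2 * pi)) = 1"
    using cis_multiple_2pi[of "of_int n"] by (simp add: mult_ac)
  ultimately have "integral {0..2 * pi} (\<lambda>x. cis (of_int n * x)) = 0"
    by (simp add: integral_unique)
  moreover have "integrable (lebesgue_on {0..2 * pi}) (\<lambda>x. cis (of_int n * x))"
    by (intro continuous_imp_integrable_real continuous_intros)
  ultimately show ?thesis
    using False by (simp add: lebesgue_integral_eq_integral)
qed

lemma fourier_coeff_eq_integral:
  "of_real (2 * pi) * fourier_coeff u k =
     (LINT x|lebesgue_on {0..2 * pi}. u x * cnj (cis (of_int k * x)))"
proof -
  have "exp (- (\<i> * of_int k * complex_of_real x)) = cnj (cis (of_int k * x))" for x
    by (subst cis_cnj) (simp add: cis_conv_exp mult.assoc)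
  then show ?thesis
    by (simp add: fourier_coeff_def set_lebesgue_integral_lebesgue_on)
qed

text \<open>Completing the square with the orthogonality of the exponentials. The last term vanishes
  when b is the Fourier coefficient, which gives Bessel, and it is nonnegative for any b, which
  gives Parseval from density.\<close>

lemma integral_norm_diff_trig_sum:
  assumes u: "square_integrable (lebesgue_on {0..2 * pi}) u" and F: "finite F"
  shows "(LINT x|lebesgue_on {0..2 * pi}. (cmod (u x - (\<Sum>k\<in>F. b k * cis (of_int k * x))))\<^sup>2) =
    (LINT x|lebesgue_on {0..2 * pi}. (cmod (u x))\<^sup>2) - 2 * pi * (\<Sum>k\<in>F. (cmod (fourier_coeff u k))\<^sup>2)
    + 2 * pi * (\<Sum>k\<in>F. (cmod (fourier_coeff u k - b k))\<^sup>2)"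
proof -
  let ?M = "lebesgue_on {0..2 * pi}"
  define e where "e k x = cis (of_int k * x)" for k :: int and x
  define q where "q x = (\<Sum>k\<in>F. b k * e k x)" for x
  have se: "square_integrable ?M (e k)" for k
    unfolding e_def by (intro square_integrable_continuous continuous_intros)
  have sq: "square_integrable ?M q"
    unfolding q_def e_def by (intro square_integrable_continuous continuous_intros)
  have coeff_cross: "(LINT x|?M. w x * cnj (q x)) = (\<Sum>k\<in>F. cnj (b k) * (LINT x|?M. w x * cnj (e k x)))"
    if "square_integrable ?M w" for w
  proof -
    have "(LINT x|?M. w x * cnj (q x)) = (LINT x|?M. (\<Sum>k\<in>F. cnj (b k) * (w x * cnj (e k x))))"
      by (simp add: q_def sum_distrib_left mult_ac)
    also have "\<dots> = (\<Sum>k\<in>F. cnj (b k) * (LINT x|?M. w x * cnj (e k x)))"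
      using square_integrable_mult_cnj[OF that se] by simp
    finally show ?thesis .
  qed
  have uq: "(LINT x|?M. u x * cnj (q x)) = of_real (2 * pi) * (\<Sum>k\<in>F. cnj (b k) * fourier_coeff u k)"
    unfolding coeff_cross[OF u] e_def fourier_coeff_eq_integral[symmetric]
    by (simp add: sum_distrib_left mult_ac)
  have qe: "(LINT x|?M. q x * cnj (e k x)) = of_real (2 * pi) * b k" if "k \<in> F" for k
  proof -
    have "(LINT x|?M. q x * cnj (e k x)) = (LINT x|?M. (\<Sum>l\<in>F. b l * (e l x * cnj (e k x))))"
      by (simp add: q_def sum_distrib_right mult.assoc)
    also have "\<dots> = (\<Sum>l\<in>F. b l * (LINT x|?M. e l x * cnj (e k x)))"
      using square_integrable_mult_cnj[OF se se] by simp
    also have "\<dots> = (\<Sum>l\<in>F. b l * (if l = k then of_real (2 * pi) else 0))"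
    proof (intro sum.cong refl arg_cong2[where f = "(*)"])
      fix l
      have "(LINT x|?M. e l x * cnj (e k x)) = (LINT x|?M. cis (of_int (l - k) * x))"
        by (simp add: e_def cis_cnj cis_mult algebra_simps)
      then show "(LINT x|?M. e l x * cnj (e k x)) = (if l = k then of_real (2 * pi) else 0)"
        unfolding integral_cis_of_int by simp
    qed
    also have "\<dots> = of_real (2 * pi) * b k"
      using F that by (simp add: if_distrib[of "(*) _"] sum.delta cong: if_cong)
    finally show ?thesis .
  qed
  have qq: "(LINT x|?M. q x * cnj (q x)) = of_real (2 * pi) * (\<Sum>k\<in>F. cnj (b k) * b k)"
    unfolding coeff_cross[OF sq] sum_distrib_left
    by (intro sum.cong refl) (subst qe, assumption, simp add: mult_ac)
  have qu: "(LINT x|?M. q x * cnj (u x)) = cnj (LINT x|?M. u x * cnj (q x))"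
    by (subst Bochner_Integration.integral_cnj[symmetric]) (simp add: mult.commute)
  note int = square_integrable_mult_cnj[OF u u] square_integrable_mult_cnj[OF u sq]
    square_integrable_mult_cnj[OF sq u] square_integrable_mult_cnj[OF sq sq]
  have "complex_of_real (LINT x|?M. (cmod (u x - q x))\<^sup>2) = (LINT x|?M. (u x - q x) * cnj (u x - q x))"
    by (simp only: complex_norm_square[symmetric] integral_complex_of_real)
  also have "\<dots> = (LINT x|?M. u x * cnj (u x) - u x * cnj (q x) - q x * cnj (u x) + q x * cnj (q x))"
    by (simp add: algebra_simps)
  also have "\<dots> = (LINT x|?M. u x * cnj (u x)) - (LINT x|?M. u x * cnj (q x))
      - (LINT x|?M. q x * cnj (u x)) + (LINT x|?M. q x * cnj (q x))"
    using int by simp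
  also have "(LINT x|?M. u x * cnj (u x)) = of_real (LINT x|?M. (cmod (u x))\<^sup>2)"
    by (simp only: complex_norm_square[symmetric] integral_complex_of_real)
  also have "of_real (LINT x|?M. (cmod (u x))\<^sup>2) - (LINT x|?M. u x * cnj (q x))
      - (LINT x|?M. q x * cnj (u x)) + (LINT x|?M. q x * cnj (q x)) =
     of_real ((LINT x|?M. (cmod (u x))\<^sup>2) - 2 * pi * (\<Sum>k\<in>F. (cmod (fourier_coeff u k))\<^sup>2)
    + 2 * pi * (\<Sum>k\<in>F. (cmod (fourier_coeff u k - b k))\<^sup>2))"
    unfolding qu uq qq of_real_add of_real_diff of_real_mult of_real_sum complex_norm_square
    by (simp add: algebra_simps sum.distrib sum_subtractf)
  finally show ?thesis
    unfolding q_def e_def of_real_eq_iff .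
qed

lemma bessel:
  assumes "square_integrable (lebesgue_on {0..2 * pi}) u" "finite F"
  shows "2 * pi * (\<Sum>k\<in>F. (cmod (fourier_coeff u k))\<^sup>2) \<le> (LINT x|lebesgue_on {0..2 * pi}. (cmod (u x))\<^sup>2)"
proof -
  have "0 \<le> (LINT x|lebesgue_on {0..2 * pi}. (cmod (u x - (\<Sum>k\<in>F. fourier_coeff u k * cis (of_int k * x))))\<^sup>2)"
    by simp
  then show ?thesis
    unfolding integral_norm_diff_trig_sum[OF assms] by simp
qed

text \<open>The index set of any good trigonometric approximation works, because Fourier
  coefficients are the best choice on it. Stating Parseval with finite sets avoids infinite sums of
  coefficients.\<close>

lemma parseval_approx:
  assumes "square_integrable (lebesgue_on {0..2 * pi}) u" "\<epsilon> > 0"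
  obtains F where "finite F" "(LINT x|lebesgue_on {0..2 * pi}. (cmod (u x))\<^sup>2) <
    2 * pi * (\<Sum>k\<in>F. (cmod (fourier_coeff u k))\<^sup>2) + \<epsilon>"
proof -
  obtain q where q: "trig_poly q" "(LINT x|lebesgue_on {0..2 * pi}. (cmod (u x - q x))\<^sup>2) < \<epsilon>"
    using trig_poly_L2_approx[OF assms] .
  then obtain F b where F: "finite F" "q = (\<lambda>x. \<Sum>k\<in>F. b k * cis (of_int k * x))"
    unfolding trig_poly_def by blast
  have "0 \<le> 2 * pi * (\<Sum>k\<in>F. (cmod (fourier_coeff u k - b k))\<^sup>2)"
    by (simp add: sum_nonneg)
  then show ?thesis
    using that[OF F(1)] q(2) unfolding F(2) integral_norm_diff_trig_sum[OF assms(1) F(1)] by simp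
qed

section \<open>Convergence in the mean\<close>

lemma AE_summable_of_integrals:
  fixes f :: "nat \<Rightarrow> 'a \<Rightarrow> real"
  assumes "\<And>n. integrable M (f n)" "\<And>n x. 0 \<le> f n x" "summable (\<lambda>n. LINT x|M. f n x)"
  shows "AE x in M. summable (\<lambda>n. f n x)"
proof -
  have "(\<integral>\<^sup>+x. (\<Sum>n. ennreal (f n x)) \<partial>M) = (\<Sum>n. \<integral>\<^sup>+x. ennreal (f n x) \<partial>M)"
    using assms(1) by (intro nn_integral_suminf) auto
  also have "\<dots> = (\<Sum>n. ennreal (LINT x|M. f n x))"
    using assms by (intro suminf_cong nn_integral_eq_integral) auto
  also have "\<dots> \<noteq> \<infinity>"
    using assms by (simp add: suminf_ennreal2)
  finally have "AE x in M. (\<Sum>n. ennreal (f n x)) \<noteq> \<infinity>"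
    using assms(1) by (intro nn_integral_PInf_AE) auto
  then show ?thesis
    by eventually_elim (auto intro: summable_suminf_not_top assms(2))
qed

text \<open>The rate 8^(-n) leaves room for the weight 2^n, so the sum of 2^n |D n|^2 is finite
  almost everywhere. Either |D n| \<le> 2^(-n) or |D n| \<le> 2^n |D n|^2, so the increments are
  absolutely summable there, without Cauchy-Schwarz.\<close>

lemma AE_convergent_fast_Cauchy_L2:
  assumes "\<And>n. square_integrable M (S n)"
    and "\<And>n. (LINT x|M. (cmod (S (Suc n) x - S n x))\<^sup>2) \<le> (1 / 8) ^ n"
  shows "AE x in M. convergent (\<lambda>n. S n x)"
proof -
  define D where "D n x = S (Suc n) x - S n x" for n x
  have sq: "square_integrable M (D n)" for n
    unfolding D_def by (intro square_integrable_diff assms)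
  have "AE x in M. summable (\<lambda>n. 2 ^ n * (cmod (D n x))\<^sup>2)"
  proof (rule AE_summable_of_integrals)
    show "integrable M (\<lambda>x. 2 ^ n * (cmod (D n x))\<^sup>2)" for n
      using sq[of n] by (simp add: square_integrable_def)
    show "summable (\<lambda>n. LINT x|M. 2 ^ n * (cmod (D n x))\<^sup>2)"
    proof (rule summable_comparison_test[OF _ summable_geometric[of "1 / 4::real"]], intro exI allI impI)
      fix n
      have "2 ^ n * (LINT x|M. (cmod (D n x))\<^sup>2) \<le> 2 ^ n * (1 / 8) ^ n"
        using assms(2)[of n] unfolding D_def by (intro mult_left_mono) auto
      also have "\<dots> = (1 / 4) ^ n"
        by (simp add: power_mult_distrib[symmetric])
      finally show "norm (LINT x|M. 2 ^ n * (cmod (D n x))\<^sup>2) \<le> (1 / 4) ^ n"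
        by simp
    qed simp
  qed auto
  then show ?thesis
  proof eventually_elim
    case (elim x)
    have "summable (\<lambda>n. (1 / 2) ^ n + 2 ^ n * (cmod (D n x))\<^sup>2)"
      by (intro summable_add summable_geometric elim) simp
    then have "summable (\<lambda>n. D n x)"
    proof (rule summable_comparison_test[rotated], intro exI allI impI)
      fix n
      show "norm (D n x) \<le> (1 / 2) ^ n + 2 ^ n * (cmod (D n x))\<^sup>2"
      proof (cases "cmod (D n x) \<le> (1 / 2) ^ n")
        case False
        then have "1 \<le> 2 ^ n * cmod (D n x)"
          by (simp add: power_one_over field_simps)
        then have "1 * cmod (D n x) \<le> (2 ^ n * cmod (D n x)) * cmod (D n x)"
          by (intro mult_right_mono) auto
        moreover have "0 \<le> (1 / 2 :: real) ^ n" by simp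
        ultimately show ?thesis by (simp add: power2_eq_square mult.assoc del: zero_le_power)
      qed (simp add: add_increasing2)
    qed
    then have "convergent (\<lambda>n. \<Sum>i<n. D i x)"
      by (simp add: summable_iff_convergent)
    then have "convergent (\<lambda>n. (\<Sum>i<n. D i x) + S 0 x)"
      by (intro convergent_add convergent_const)
    moreover have "(\<Sum>i<n. D i x) = S n x - S 0 x" for n
      unfolding D_def by (rule sum_lessThan_telescope)
    ultimately show ?case by simp
  qed
qed

lemma fatou_L2:
  assumes f: "f \<in> borel_measurable M" "AE x in M. (\<lambda>n. S n x) \<longlonglongrightarrow> f x"
    and sq: "\<And>n. square_integrable M (S n)" "square_integrable M g"
    and le: "\<And>n. n \<ge> N \<Longrightarrow> (LINT x|M. (cmod (S n x - g x))\<^sup>2) \<le> K"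
  shows "square_integrable M (\<lambda>x. f x - g x)" "(LINT x|M. (cmod (f x - g x))\<^sup>2) \<le> K"
proof -
  have sqd: "integrable M (\<lambda>x. (cmod (S n x - g x))\<^sup>2)" for n
    using square_integrable_diff[OF sq] by (simp add: square_integrable_def)
  have mf: "(\<lambda>x. f x - g x) \<in> borel_measurable M"
    using f(1) sq(2) by (intro borel_measurable_diff) (auto simp: square_integrable_def)
  have "(\<integral>\<^sup>+x. ennreal ((cmod (f x - g x))\<^sup>2) \<partial>M) =
      (\<integral>\<^sup>+x. liminf (\<lambda>n. ennreal ((cmod (S n x - g x))\<^sup>2)) \<partial>M)"
  proof (rule nn_integral_cong_AE)
    show "AE x in M. ennreal ((cmod (f x - g x))\<^sup>2) = liminf (\<lambda>n. ennreal ((cmod (S n x - g x))\<^sup>2))"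
      using f(2)
    proof eventually_elim
      case (elim x)
      have "(\<lambda>n. ennreal ((cmod (S n x - g x))\<^sup>2)) \<longlonglongrightarrow> ennreal ((cmod (f x - g x))\<^sup>2)"
        by (intro tendsto_ennrealI tendsto_intros elim)
      then show ?case
        by (intro lim_imp_Liminf[symmetric]) simp_all
    qed
  qed
  also have "\<dots> \<le> liminf (\<lambda>n. \<integral>\<^sup>+x. ennreal ((cmod (S n x - g x))\<^sup>2) \<partial>M)"
    using sqd by (intro nn_integral_liminf) auto
  also have "\<dots> \<le> ennreal K"
  proof (rule Liminf_le)
    show "\<forall>\<^sub>F n in sequentially. (\<integral>\<^sup>+x. ennreal ((cmod (S n x - g x))\<^sup>2) \<partial>M) \<le> ennreal K"
      unfolding eventually_sequentially
      using le by (intro exI[of _ N]) (simp add: nn_integral_eq_integral[OF sqd] ennreal_leI)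
  qed simp
  finally have fin: "(\<integral>\<^sup>+x. ennreal ((cmod (f x - g x))\<^sup>2) \<partial>M) \<le> ennreal K" .
  have int: "integrable M (\<lambda>x. (cmod (f x - g x))\<^sup>2)"
  proof (rule integrableI_bounded)
    show "(\<lambda>x. (cmod (f x - g x))\<^sup>2) \<in> borel_measurable M"
      using mf by measurable
    show "(\<integral>\<^sup>+x. ennreal (norm ((cmod (f x - g x))\<^sup>2)) \<partial>M) < \<infinity>"
      using fin by (simp add: order_le_less_trans)
  qed
  then show "square_integrable M (\<lambda>x. f x - g x)"
    using mf by (simp add: square_integrable_def)
  have "0 \<le> (LINT x|M. (cmod (S N x - g x))\<^sup>2)" by simp
  then have "0 \<le> K" using le[of N] by linarith
  then show "(LINT x|M. (cmod (f x - g x))\<^sup>2) \<le> K"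
    using fin by (simp add: nn_integral_eq_integral[OF int])
qed

lemma square_integrable_sum:
  "finite F \<Longrightarrow> (\<And>k. k \<in> F \<Longrightarrow> square_integrable M (\<phi> k)) \<Longrightarrow> square_integrable M (\<lambda>x. \<Sum>k\<in>F. \<phi> k x)"
proof (induction F rule: finite_induct)
  case empty
  then show ?case by (simp add: square_integrable_def)
next
  case (insert k F)
  have "square_integrable M (\<lambda>x. \<phi> k x - (0 - (\<Sum>k\<in>F. \<phi> k x)))"
    using insert by (intro square_integrable_diff) (auto simp: square_integrable_def)
  then show ?case using insert by simp
qed

text \<open>If the sum over G is within \<epsilon> of the supremum of all finite sums, a set
  disjoint from G can add at most \<epsilon>.\<close>

lemma small_tail_sum:
  fixes w :: "'i \<Rightarrow> real"
  assumes "\<And>F. finite F \<Longrightarrow> sum w F \<le> K" "\<epsilon> > 0"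
  obtains G where "finite G" "\<And>H. finite H \<Longrightarrow> H \<inter> G = {} \<Longrightarrow> sum w H \<le> \<epsilon>"
proof -
  let ?X = "sum w ` {F. finite F}"
  have bdd: "bdd_above ?X" using assms(1) by (auto intro!: bdd_aboveI2)
  have "Sup ?X - \<epsilon> < Sup ?X" using assms(2) by simp
  then obtain G where G: "finite G" "Sup ?X - \<epsilon> < sum w G"
    using less_cSup_iff[of ?X "Sup ?X - \<epsilon>"] bdd by auto
  show ?thesis
  proof
    fix H assume H: "finite H" "H \<inter> G = {}"
    have "sum w (H \<union> G) \<le> Sup ?X"
      using H G by (intro cSup_upper bdd) auto
    then show "sum w H \<le> \<epsilon>"
      using sum.union_disjoint[OF H(1) G(1) H(2), of w] G(2) by linarith
  qed (rule G(1))
qed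

text \<open>Riesz-Fischer for unconditional convergence: the limit is built along one increasing
  sequence of finite sets with tails 8^(-n), and Fatou then compares it with the partial sum over
  any larger finite set.\<close>

lemma exists_unconditional_L2_sum:
  fixes \<phi> :: "'i \<Rightarrow> real \<Rightarrow> complex"
  assumes S: "S \<in> sets lebesgue"
    and m: "\<And>k. \<phi> k \<in> borel_measurable lebesgue"
    and sq: "\<And>k. square_integrable (lebesgue_on S) (\<phi> k)"
    and w: "\<And>F. finite F \<Longrightarrow> sum w F \<le> K"
    and C: "C > 0" "\<And>F. finite F \<Longrightarrow> (LINT x|lebesgue_on S. (cmod (\<Sum>k\<in>F. \<phi> k x))\<^sup>2) \<le> C * sum w F"
  shows "\<exists>f. f \<in> borel_measurable lebesgue \<and> square_integrable (lebesgue_on S) f \<and>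
    ((\<lambda>F. LINT x|lebesgue_on S. (cmod (f x - (\<Sum>k\<in>F. \<phi> k x)))\<^sup>2) \<longlongrightarrow> 0) (finite_subsets_at_top UNIV)"
proof -
  let ?M = "lebesgue_on S"
  define s where "s F x = (\<Sum>k\<in>F. \<phi> k x)" for F x
  have sqs: "square_integrable ?M (s F)" if "finite F" for F
    unfolding s_def using that sq by (rule square_integrable_sum)
  have "\<exists>G. finite G \<and> (\<forall>H. finite H \<longrightarrow> H \<inter> G = {} \<longrightarrow> sum w H \<le> (1 / 8) ^ n / C)" for n
    using small_tail_sum[OF w, where \<epsilon> = "(1 / 8) ^ n / C"] C(1) by (metis divide_pos_pos zero_less_power zero_less_divide_1_iff zero_less_numeral)
  then obtain G0 where G0: "\<And>n. finite (G0 n)"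
    "\<And>n H. finite H \<Longrightarrow> H \<inter> G0 n = {} \<Longrightarrow> sum w H \<le> (1 / 8) ^ n / C"
    by metis
  define G where "G n = (\<Union>i\<le>n. G0 i)" for n
  have finG: "finite (G n)" for n unfolding G_def using G0(1) by auto
  have incG: "G m \<subseteq> G n" if "m \<le> n" for m n
    using that unfolding G_def by fastforce
  have tail: "(LINT x|?M. (cmod (s H x))\<^sup>2) \<le> (1 / 8) ^ n" if "finite H" "H \<inter> G n = {}" for H n
  proof -
    have "sum w H \<le> (1 / 8) ^ n / C"
      using that by (intro G0(2)) (auto simp: G_def)
    then have "C * sum w H \<le> (1 / 8) ^ n"
      using C(1) by (simp add: field_simps)
    then show ?thesis using C(2)[OF that(1)] unfolding s_def by linarith
  qed
  have "AE x in ?M. convergent (\<lambda>n. s (G n) x)"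
  proof (rule AE_convergent_fast_Cauchy_L2)
    show "square_integrable ?M (s (G n))" for n by (intro sqs finG)
    fix n
    have "s (G (Suc n)) x - s (G n) x = s (G (Suc n) - G n) x" for x
      unfolding s_def using finG incG[of n "Suc n"] by (simp add: sum_diff)
    then show "(LINT x|?M. (cmod (s (G (Suc n)) x - s (G n) x))\<^sup>2) \<le> (1 / 8) ^ n"
      using tail[of "G (Suc n) - G n" n] finG by auto
  qed
  then have lim: "AE x in ?M. (\<lambda>n. s (G n) x) \<longlonglongrightarrow> lim (\<lambda>n. s (G n) x)"
    by eventually_elim (simp add: convergent_LIMSEQ_iff)
  \<comment> \<open>Where the sequence diverges, \<open>lim\<close> is an arbitrary value; within S
    this happens only on a null set, and f is still measurable on the whole line.\<close>
  define f where "f x = lim (\<lambda>n. s (G n) x)" for x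
  have mf: "f \<in> borel_measurable lebesgue"
    unfolding f_def s_def using m by (intro borel_measurable_lim_metric borel_measurable_sum)
  have mf': "f \<in> borel_measurable ?M"
    using mf by (rule measurable_restrict_space1)
  have close: "square_integrable ?M (\<lambda>x. f x - s F x)" "(LINT x|?M. (cmod (f x - s F x))\<^sup>2) \<le> 4 * (1 / 8) ^ N"
    if F: "finite F" "G N \<subseteq> F" for F N
  proof -
    have "(LINT x|?M. (cmod (s (G n) x - s F x))\<^sup>2) \<le> 4 * (1 / 8) ^ N" if "n \<ge> N" for n
    proof -
      \<comment> \<open>The common part of the two partial sums cancels. Both remaining index sets
        avoid \<open>G N\<close>, so each contributes at most 2 times 8^(-N).\<close>
      define A where "A = G n - F"
      define B where "B = F - G n"
      have AB: "finite A" "finite B" "A \<inter> G N = {}" "B \<inter> G N = {}"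
        using finG F incG[OF that] by (auto simp: A_def B_def)
      have "s (G n) x - s F x = s A x - s B x" for x
      proof -
        have "s (G n) x = s A x + s (G n \<inter> F) x" "s F x = s B x + s (G n \<inter> F) x"
          unfolding s_def A_def B_def using finG F(1)
          by (metis Diff_Int_distrib add.commute sum.Int_Diff inf_commute)+
        then show ?thesis by simp
      qed
      then have "(LINT x|?M. (cmod (s (G n) x - s F x))\<^sup>2) = (LINT x|?M. (cmod (s A x - s B x))\<^sup>2)"
        by simp
      also have "\<dots> \<le> 2 * (LINT x|?M. (cmod (s A x - 0))\<^sup>2) + 2 * (LINT x|?M. (cmod (0 - s B x))\<^sup>2)"
        using AB by (intro integral_norm_diff_square_le sqs) (auto simp: square_integrable_def)
      also have "\<dots> \<le> 4 * (1 / 8) ^ N"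
        using tail[OF AB(1,3)] tail[OF AB(2,4)] by simp
      finally show ?thesis .
    qed
    then show "square_integrable ?M (\<lambda>x. f x - s F x)" "(LINT x|?M. (cmod (f x - s F x))\<^sup>2) \<le> 4 * (1 / 8) ^ N"
      using fatou_L2[OF mf'[unfolded f_def] lim sqs[OF finG] sqs[OF F(1)], where N = N and K = "4 * (1 / 8) ^ N"]
      lim finG unfolding f_def by blast+
  qed
  have "square_integrable ?M (\<lambda>x. (f x - s (G 0) x) - (0 - s (G 0) x))"
    by (intro square_integrable_diff close(1)[of _ 0] sqs finG) (auto simp: square_integrable_def finG)
  then have "square_integrable ?M f" by simp
  moreover have "((\<lambda>F. LINT x|?M. (cmod (f x - s F x))\<^sup>2) \<longlongrightarrow> 0) (finite_subsets_at_top UNIV)"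
  proof (rule tendstoI)
    fix e :: real assume "e > 0"
    then obtain N where N: "(1 / 8) ^ N < e / 4"
      using real_arch_pow_inv[of "e / 4" "1 / 8"] by auto
    show "\<forall>\<^sub>F F in finite_subsets_at_top UNIV. dist (LINT x|?M. (cmod (f x - s F x))\<^sup>2) 0 < e"
      unfolding eventually_finite_subsets_at_top
    proof (intro exI[of _ "G N"] conjI allI impI)
      fix F assume "finite F \<and> G N \<subseteq> F \<and> F \<subseteq> UNIV"
      then have "(LINT x|?M. (cmod (f x - s F x))\<^sup>2) < e"
        using close(2)[of F N] N by auto
      then show "dist (LINT x|?M. (cmod (f x - s F x))\<^sup>2) 0 < e"
        by simp
    qed (auto intro: finG)
  qed
  ultimately show ?thesis
    using mf unfolding s_def by blast
qed

section \<open>Observability\<close>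

text \<open>Inverting the hypothesis gives 2 pi / T < \<open>gamma' p v\<close>, so some W has an
  infimum above 2 pi / T. Both quantities may be infinite; a real \<gamma> is interposed below the
  infimum.\<close>

lemma gamma'_obtain_separated:
  assumes "gamma' p v > 0" "ereal T > ereal (2 * pi) / gamma' p v"
  obtains W \<gamma> where "finite W" "W \<subseteq> Lambda_set p v" "\<gamma> > 0" "T > 2 * pi / \<gamma>"
    "separated \<gamma> (Lambda_set p v - W)"
proof -
  have "0 \<le> ereal (2 * pi) / gamma' p v"
    using assms(1) by simp
  then have T: "T > 0" using assms(2) by (metis ereal_less(2) order_le_less_trans)
  have "ereal (2 * pi / T) < gamma' p v"
  proof (cases "gamma' p v")
    case (real r)
    then have "r > 0" "T > 2 * pi / r" using assms by auto
    then show ?thesis using T real by (simp add: field_simps)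
  qed (use assms in auto)
  then obtain W where W: "finite W" "W \<subseteq> Lambda_set p v"
    "ereal (2 * pi / T) < (INF (l, l') \<in> {(l, l'). l \<in> Lambda_set p v - W \<and> l' \<in> Lambda_set p v - W \<and> l \<noteq> l'}. ereal \<bar>l - l'\<bar>)"
    unfolding gamma'_def less_SUP_iff by blast
  then obtain \<gamma> where \<gamma>: "ereal (2 * pi / T) < ereal \<gamma>"
    "ereal \<gamma> < (INF (l, l') \<in> {(l, l'). l \<in> Lambda_set p v - W \<and> l' \<in> Lambda_set p v - W \<and> l \<noteq> l'}. ereal \<bar>l - l'\<bar>)"
    using ereal_dense2 by blast
  show ?thesis
  proof
    have "2 * pi / T > 0" using T by simp
    then show "\<gamma> > 0" using \<gamma>(1) by (simp add: order_less_trans)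
    then show "T > 2 * pi / \<gamma>" using \<gamma>(1) T by (simp add: field_simps)
    show "separated \<gamma> (Lambda_set p v - W)"
      unfolding separated_def
    proof (intro ballI impI)
      fix x y assume "x \<in> Lambda_set p v - W" "y \<in> Lambda_set p v - W" "x \<noteq> y"
      then have "ereal \<gamma> < ereal \<bar>x - y\<bar>"
        using less_INF_D[OF \<gamma>(2), of "(x, y)"] by simp
      then show "\<gamma> \<le> \<bar>x - y\<bar>" by simp
    qed
  qed (use W in auto)
qed

text \<open>An admissible time exists, so a claim about all admissible T cannot hold
  vacuously.\<close>

lemma gamma'_obtain_time:
  assumes "gamma' p v > 0"
  obtains T where "ereal T > ereal (2 * pi) / gamma' p v"
proof -
  have "ereal (2 * pi) / gamma' p v < \<infinity>"
    using assms by (cases "gamma' p v") auto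
  then show ?thesis using that ereal_dense2 by blast
qed

lemma inj_freq: "Pi_set p v = {} \<Longrightarrow> inj (freq p v)"
  by (auto simp: Pi_set_def intro!: injI) metis

lemma line_term_cis:
  assumes "solution p u0 u" "u0 \<in> L2_circle"
  shows "line_term u t0 x0 v k t =
    (fourier_coeff u0 k * cis (p k * t0 + of_int k * x0)) * cis (freq p v k * t)"
  unfolding line_term_solution[OF assms] cis_conv_exp by simp

text \<open>One coefficient function serves all F. The phases that depend on \<open>t0\<close> and
  \<open>x0\<close> have modulus one, so the sum of squares is that of the initial datum.\<close>

lemma sum_line_term_eq_expsum:
  assumes "solution p u0 u" "u0 \<in> L2_circle" "inj (freq p v)"
  shows "\<exists>a. \<forall>F t. (\<Sum>k\<in>F. line_term u t0 x0 v k t) = expsum (freq p v ` F) a t \<and>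
    (\<Sum>l\<in>freq p v ` F. (cmod (a l))\<^sup>2) = (\<Sum>k\<in>F. (cmod (fourier_coeff u0 k))\<^sup>2)"
proof -
  define c where "c k = fourier_coeff u0 k * cis (p k * t0 + of_int k * x0)" for k
  have inj: "inj_on (freq p v) F" for F
    using assms(3) by (rule inj_on_subset) auto
  show ?thesis
  proof (intro exI[of _ "\<lambda>l. c (inv (freq p v) l)"] allI conjI)
    fix F t
    show "(\<Sum>k\<in>F. line_term u t0 x0 v k t) = expsum (freq p v ` F) (\<lambda>l. c (inv (freq p v) l)) t"
      unfolding expsum_def sum.reindex[OF inj] line_term_cis[OF assms(1,2)] c_def
      using assms(3) by simp
    show "(\<Sum>l\<in>freq p v ` F. (cmod (c (inv (freq p v) l)))\<^sup>2) = (\<Sum>k\<in>F. (cmod (fourier_coeff u0 k))\<^sup>2)"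
      unfolding sum.reindex[OF inj] c_def using assms(3) by (simp add: norm_mult)
  qed
qed

lemma lebesgue_integral_expsum:
  "(LINT t|lebesgue_on {0..T}. (cmod (expsum F a t))\<^sup>2) = integral {0..T} (\<lambda>t. (cmod (expsum F a t))\<^sup>2)"
  by (intro lebesgue_integral_eq_integral continuous_imp_integrable_real continuous_intros) auto

text \<open>The finite exceptional set is put back into the spectrum at the price of a smaller gap,
  which the upper bound tolerates for every T. Bessel makes the coefficients square summable, and
  the series converges unconditionally.\<close>

lemma line_restriction_exists:
  assumes "gamma' p v > 0" "Pi_set p v = {}" "u0 \<in> L2_circle" "solution p u0 u"
  shows "\<exists>f. line_restriction u t0 x0 v T f"
proof -
  \<comment> \<open>This auxiliary time, unrelated to T, only serves to extract a finite W and a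
    positive gap.\<close>
  obtain T' where "ereal T' > ereal (2 * pi) / gamma' p v"
    using gamma'_obtain_time[OF assms(1)] by blast
  then obtain W \<gamma> where W: "finite W" "\<gamma> > 0" "W \<subseteq> Lambda_set p v" "separated \<gamma> (Lambda_set p v - W)"
    using gamma'_obtain_separated[OF assms(1)] by metis
  then obtain \<delta> where "\<delta> > 0" "separated \<delta> (W \<union> (Lambda_set p v - W))"
    using separated_Un_finite by blast
  then obtain C where C: "C > 0" "\<And>F a. finite F \<Longrightarrow> F \<subseteq> Lambda_set p v \<Longrightarrow>
      integral {0..T} (\<lambda>t. (cmod (expsum F a t))\<^sup>2) \<le> C * (\<Sum>l\<in>F. (cmod (a l))\<^sup>2)"
    using expsum_upper_bound_separated[of \<delta> "W \<union> (Lambda_set p v - W)" T] W(3) by (auto simp: Un_absorb1)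
  obtain a where a: "\<And>F t. (\<Sum>k\<in>F. line_term u t0 x0 v k t) = expsum (freq p v ` F) a t"
    "\<And>F. (\<Sum>l\<in>freq p v ` F. (cmod (a l))\<^sup>2) = (\<Sum>k\<in>F. (cmod (fourier_coeff u0 k))\<^sup>2)"
    using sum_line_term_eq_expsum[OF assms(4,3) inj_freq[OF assms(2)]] by metis
  have cont: "continuous_on A (line_term u t0 x0 v k)" for k A
    unfolding line_term_cis[OF assms(4,3), abs_def] by (intro continuous_intros)
  have "\<exists>f. f \<in> borel_measurable lebesgue \<and> square_integrable (lebesgue_on {0..T}) f \<and>
    ((\<lambda>F. LINT x|lebesgue_on {0..T}. (cmod (f x - (\<Sum>k\<in>F. line_term u t0 x0 v k x)))\<^sup>2) \<longlongrightarrow> 0) (finite_subsets_at_top UNIV)"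
  proof (rule exists_unconditional_L2_sum[OF _ _ _ _ C(1)])
    show "line_term u t0 x0 v k \<in> borel_measurable lebesgue" for k
      by (intro measurable_completion) (auto intro!: borel_measurable_continuous_onI cont)
    show "square_integrable (lebesgue_on {0..T}) (line_term u t0 x0 v k)" for k
      by (intro square_integrable_continuous cont)
    show "(\<Sum>k\<in>F. (cmod (fourier_coeff u0 k))\<^sup>2) \<le> (LINT x|lebesgue_on {0..2 * pi}. (cmod (u0 x))\<^sup>2) / (2 * pi)"
      if "finite F" for F
      using bessel[OF L2_circle_square_integrable[OF assms(3)] that] by (simp add: field_simps)
    show "(LINT x|lebesgue_on {0..T}. (cmod (\<Sum>k\<in>F. line_term u t0 x0 v k x))\<^sup>2)
       \<le> C * (\<Sum>k\<in>F. (cmod (fourier_coeff u0 k))\<^sup>2)" if "finite F" for F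
      unfolding a(1) a(2)[symmetric] lebesgue_integral_expsum
      using that by (intro C(2)) (auto simp: Lambda_set_def)
  qed simp
  then show ?thesis
    unfolding line_restriction_def set_lebesgue_integral_lebesgue_on set_integrable_lebesgue_on
      square_integrable_def by blast
qed

lemma observability_if_Pi_empty:
  assumes "gamma' p v > 0" "Pi_set p v = {}" "ereal T > ereal (2 * pi) / gamma' p v"
  shows "observability_inequality p v t0 x0 T"
proof -
  obtain W \<gamma> where W: "finite W" "\<gamma> > 0" "W \<subseteq> Lambda_set p v" "separated \<gamma> (Lambda_set p v - W)"
    "T > 2 * pi / \<gamma>"
    using gamma'_obtain_separated[OF assms(1,3)] by metis
  then have "bounded_below T (W \<union> (Lambda_set p v - W))"
    by (intro bounded_below_Un_finite)
  then obtain C where C: "C > 0" "\<And>F a. finite F \<Longrightarrow> F \<subseteq> Lambda_set p v \<Longrightarrow>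
      (\<Sum>l\<in>F. (cmod (a l))\<^sup>2) \<le> C * integral {0..T} (\<lambda>t. (cmod (expsum F a t))\<^sup>2)"
    using W(3) unfolding bounded_below_def by (auto simp: Un_absorb1)
  show ?thesis
    unfolding observability_inequality_def set_lebesgue_integral_lebesgue_on
  \<comment> \<open>2 pi comes from Parseval, and a further factor 2 from passing from partial sums
    to f.\<close>
  proof (intro exI[of _ "4 * pi * C"] conjI ballI allI impI)
    fix u0 u f
    assume u0: "u0 \<in> L2_circle" and u: "solution p u0 u" and f: "line_restriction u t0 x0 v T f"
    let ?M = "lebesgue_on {0..T}"
    let ?L = "finite_subsets_at_top (UNIV :: int set)"
    define R where "R F = (LINT t|?M. (cmod (f t - (\<Sum>k\<in>F. line_term u t0 x0 v k t)))\<^sup>2)" for F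
    define N where "N = (LINT t|?M. (cmod (f t))\<^sup>2)"
    have sqf: "square_integrable ?M f" and R: "(R \<longlongrightarrow> 0) ?L"
      using f unfolding line_restriction_def set_lebesgue_integral_lebesgue_on set_integrable_lebesgue_on
        R_def square_integrable_def by (auto intro: measurable_restrict_space1)
    obtain a where a: "\<And>F t. (\<Sum>k\<in>F. line_term u t0 x0 v k t) = expsum (freq p v ` F) a t"
      "\<And>F. (\<Sum>l\<in>freq p v ` F. (cmod (a l))\<^sup>2) = (\<Sum>k\<in>F. (cmod (fourier_coeff u0 k))\<^sup>2)"
      using sum_line_term_eq_expsum[OF u u0 inj_freq[OF assms(2)]] by metis
    have bound: "(\<Sum>k\<in>F. (cmod (fourier_coeff u0 k))\<^sup>2) \<le> C * (2 * R F + 2 * N)" if "finite F" for F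
    proof -
      have "(LINT t|?M. (cmod (expsum (freq p v ` F) a t - 0))\<^sup>2) \<le>
         2 * (LINT t|?M. (cmod (expsum (freq p v ` F) a t - f t))\<^sup>2) + 2 * (LINT t|?M. (cmod (f t - 0))\<^sup>2)"
        by (intro integral_norm_diff_square_le sqf square_integrable_continuous continuous_intros)
      also have "\<dots> = 2 * R F + 2 * N"
        by (simp add: R_def N_def a(1) norm_minus_commute)
      finally have "integral {0..T} (\<lambda>t. (cmod (expsum (freq p v ` F) a t))\<^sup>2) \<le> 2 * R F + 2 * N"
        by (simp add: lebesgue_integral_expsum)
      then have "C * integral {0..T} (\<lambda>t. (cmod (expsum (freq p v ` F) a t))\<^sup>2) \<le> C * (2 * R F + 2 * N)"
        using C(1) by (intro mult_left_mono) auto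
      moreover have "(\<Sum>l\<in>freq p v ` F. (cmod (a l))\<^sup>2) \<le> C * integral {0..T} (\<lambda>t. (cmod (expsum (freq p v ` F) a t))\<^sup>2)"
        using that by (intro C(2)) (auto simp: Lambda_set_def)
      ultimately show ?thesis unfolding a(2) by linarith
    qed
    have "(LINT x|lebesgue_on {0..2 * pi}. (cmod (u0 x))\<^sup>2) \<le> 4 * pi * C * N + \<epsilon>" if \<epsilon>: "\<epsilon> > 0" for \<epsilon>
    proof -
      obtain F0 where F0: "finite F0" "(LINT x|lebesgue_on {0..2 * pi}. (cmod (u0 x))\<^sup>2) <
          2 * pi * (\<Sum>k\<in>F0. (cmod (fourier_coeff u0 k))\<^sup>2) + \<epsilon>"
        using parseval_approx[OF L2_circle_square_integrable[OF u0] \<epsilon>] .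
      \<comment> \<open>The set F0 from Parseval is fixed first, and F then grows past it until the
        remainder R vanishes.\<close>
      have "((\<lambda>F. 2 * pi * (C * (2 * R F + 2 * N)) + \<epsilon>) \<longlongrightarrow> 2 * pi * (C * (2 * 0 + 2 * N)) + \<epsilon>) ?L"
        by (intro tendsto_intros R)
      moreover have "\<forall>\<^sub>F F in ?L. (LINT x|lebesgue_on {0..2 * pi}. (cmod (u0 x))\<^sup>2) \<le> 2 * pi * (C * (2 * R F + 2 * N)) + \<epsilon>"
        unfolding eventually_finite_subsets_at_top
      proof (intro exI[of _ F0] conjI allI impI)
        fix F assume F: "finite F \<and> F0 \<subseteq> F \<and> F \<subseteq> UNIV"
        then have "(\<Sum>k\<in>F0. (cmod (fourier_coeff u0 k))\<^sup>2) \<le> (\<Sum>k\<in>F. (cmod (fourier_coeff u0 k))\<^sup>2)"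
          by (intro sum_mono2) auto
        also have "\<dots> \<le> C * (2 * R F + 2 * N)" using bound F by blast
        finally have "2 * pi * (\<Sum>k\<in>F0. (cmod (fourier_coeff u0 k))\<^sup>2) \<le> 2 * pi * (C * (2 * R F + 2 * N))"
          by (intro mult_left_mono) auto
        then show "(LINT x|lebesgue_on {0..2 * pi}. (cmod (u0 x))\<^sup>2) \<le> 2 * pi * (C * (2 * R F + 2 * N)) + \<epsilon>"
          using F0(2) by linarith
      qed (use F0 in auto)
      ultimately have "(LINT x|lebesgue_on {0..2 * pi}. (cmod (u0 x))\<^sup>2) \<le> 2 * pi * (C * (2 * 0 + 2 * N)) + \<epsilon>"
        by (rule tendsto_lowerbound) simp
      then show ?thesis by simp
    qed
    then show "(LINT x|lebesgue_on {0..2 * pi}. (cmod (u0 x))\<^sup>2) \<le> 4 * pi * C * (LINT t|?M. (cmod (f t))\<^sup>2)"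
      unfolding N_def by (rule field_le_epsilon)
  qed (use C(1) in simp)
qed

section \<open>Coinciding frequencies destroy observability\<close>

lemma fourier_coeff_two_modes:
  assumes "k \<noteq> m"
  shows "fourier_coeff (\<lambda>x. a * cis (of_int k * x) + b * cis (of_int m * x)) j =
    (if j = k then a else if j = m then b else 0)"
proof -
  let ?M = "lebesgue_on {0..2 * pi}"
  have int: "integrable ?M (\<lambda>x. cis (of_int n * x))" for n
    by (intro continuous_imp_integrable_real continuous_intros)
  have "of_real (2 * pi) * fourier_coeff (\<lambda>x. a * cis (of_int k * x) + b * cis (of_int m * x)) j =
      (LINT x|?M. a * cis (of_int (k - j) * x) + b * cis (of_int (m - j) * x))"
    unfolding fourier_coeff_eq_integral
    by (intro Bochner_Integration.integral_cong refl) (simp add: cis_cnj cis_mult distrib_right mult.assoc left_diff_distrib)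
  also have "\<dots> = a * (if k - j = 0 then of_real (2 * pi) else 0) + b * (if m - j = 0 then of_real (2 * pi) else 0)"
    unfolding integral_cis_of_int[symmetric] using int[of "k - j"] int[of "m - j"] by simp
  also have "\<dots> = of_real (2 * pi) * (if j = k then a else if j = m then b else 0)"
    using assms by auto
  finally show ?thesis
    by simp
qed

lemma two_modes_in_L2_circle: "(\<lambda>x. a * cis (of_int k * x) + b * cis (of_int m * x)) \<in> L2_circle"
proof -
  have cont: "continuous_on A (\<lambda>x. a * cis (of_int k * x) + b * cis (of_int m * x))" for A
    by (intro continuous_intros)
  have "cis (of_int n * (x + 2 * pi)) = cis (of_int n * x)" for n :: int and x
  proof -
    have "cis (of_int n * (x + 2 * pi)) = cis (of_int n * x) * cis (2 * pi * of_int n)"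
      by (simp add: cis_mult algebra_simps)
    then show ?thesis by (simp add: cis_multiple_2pi)
  qed
  moreover have "(\<lambda>x. a * cis (of_int k * x) + b * cis (of_int m * x)) \<in> borel_measurable lebesgue"
    by (intro measurable_completion) (auto intro!: borel_measurable_continuous_onI cont)
  ultimately show ?thesis
    using square_integrable_continuous[OF cont]
    by (auto simp: L2_circle_def set_integrable_lebesgue_on square_integrable_def)
qed

lemma solution_two_modes:
  assumes "k \<noteq> m"
  shows "solution p (\<lambda>x. a * cis (of_int k * x) + b * cis (of_int m * x))
    (\<lambda>t x. (a * cis (p k * t)) * cis (of_int k * x) + (b * cis (p m * t)) * cis (of_int m * x))"
  unfolding solution_def fourier_coeff_two_modes[OF assms]
proof (intro conjI allI two_modes_in_L2_circle)
  fix j t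
  have d: "((\<lambda>t. c * cis (p i * t)) has_vector_derivative \<i> * (of_real (p i) * (c * cis (p i * t)))) (at t)" for c i
    using has_vector_derivative_mult_right[OF cis_has_vector_derivative, of c "p i" t UNIV]
    by (simp add: mult_ac)
  show "((\<lambda>s. if j = k then a * cis (p k * s) else if j = m then b * cis (p m * s) else 0)
     has_vector_derivative \<i> * (of_real (p j) * (if j = k then a * cis (p k * t) else if j = m then b * cis (p m * t) else 0))) (at t)"
    using d[of a k] d[of b m] by auto
qed simp

text \<open>Along the line two modes with a common frequency differ only by a constant factor, so a
  nonzero combination of them restricts to 0, at any base point and for any T.\<close>

lemma not_observable_if_Pi_nonempty:
  assumes "Pi_set p v \<noteq> {}"
  shows "\<not> observability_inequality p v t0 x0 T"
proof
  assume obs: "observability_inequality p v t0 x0 T"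
  obtain k where "k \<in> Pi_set p v" using assms by blast
  then have "\<exists>m. m \<noteq> k \<and> freq p v k = freq p v m"
    by (simp only: Pi_set_def mem_Collect_eq)
  then obtain m where "m \<noteq> k" and km2: "freq p v k = freq p v m"
    by (elim exE conjE)
  then have km: "k \<noteq> m" "freq p v k = freq p v m" by auto
  \<comment> \<open>The phase that mode j acquires at the base point; a and b undo it and give the
    two modes opposite signs.\<close>
  define \<theta> where "\<theta> j = p j * t0 + of_int j * x0" for j
  define a where "a = cis (- \<theta> k)"
  define b where "b = - cis (- \<theta> m)"
  define u0 where "u0 x = a * cis (of_int k * x) + b * cis (of_int m * x)" for x
  define u where "u t x = (a * cis (p k * t)) * cis (of_int k * x) + (b * cis (p m * t)) * cis (of_int m * x)" for t x
  have u0: "u0 \<in> L2_circle" unfolding u0_def by (rule two_modes_in_L2_circle)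
  have u: "solution p u0 u" unfolding u0_def u_def by (rule solution_two_modes[OF km(1)])
  have c: "fourier_coeff u0 j = (if j = k then a else if j = m then b else 0)" for j
    unfolding u0_def by (rule fourier_coeff_two_modes[OF km(1)])
  have lt: "line_term u t0 x0 v j t = (if j = k then cis (freq p v k * t) else if j = m then - cis (freq p v k * t) else 0)" for j t
    unfolding line_term_cis[OF u u0] c \<theta>_def[symmetric] using km by (simp add: a_def b_def cis_mult)
  have "(\<Sum>j\<in>F. line_term u t0 x0 v j t) = 0" if "finite F" "{k, m} \<subseteq> F" for F t
  proof -
    have "(\<Sum>j\<in>F. line_term u t0 x0 v j t) = (\<Sum>j\<in>{k, m}. line_term u t0 x0 v j t)"
      using that by (intro sum.mono_neutral_right) (auto simp: lt)
    also have "\<dots> = 0" using km(1) by (simp add: lt)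
    finally show ?thesis .
  qed
  then have "\<forall>\<^sub>F F in finite_subsets_at_top UNIV.
      (LINT t:{0..T}|lebesgue. (cmod (0 - (\<Sum>j\<in>F. line_term u t0 x0 v j t)))\<^sup>2) = 0"
    unfolding eventually_finite_subsets_at_top by (intro exI[of _ "{k, m}"]) auto
  then have "line_restriction u t0 x0 v T (\<lambda>_. 0)"
    unfolding line_restriction_def by (auto simp: set_integrable_def intro: tendsto_eventually)
  then have "(LINT x|lebesgue_on {0..2 * pi}. (cmod (u0 x))\<^sup>2) \<le> 0"
    using obs u0 u unfolding observability_inequality_def set_lebesgue_integral_lebesgue_on by fastforce
  \<comment> \<open>Bessel on the single mode k, whose coefficient has modulus one, already bounds
    the norm away from 0.\<close>
  moreover have "2 * pi * (\<Sum>j\<in>{k}. (cmod (fourier_coeff u0 j))\<^sup>2) \<le> (LINT x|lebesgue_on {0..2 * pi}. (cmod (u0 x))\<^sup>2)"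
    by (intro bessel L2_circle_square_integrable u0) simp
  ultimately have "2 * pi \<le> (LINT x|lebesgue_on {0..2 * pi}. (cmod (u0 x))\<^sup>2)"
      "(LINT x|lebesgue_on {0..2 * pi}. (cmod (u0 x))\<^sup>2) \<le> 0"
    by (simp_all add: c a_def)
  then show False
    using pi_gt_zero by linarith
qed

text \<open>The second conjunct rules out a vacuous reading of the first: when no frequencies
  coincide, every solution does have a restriction to the line.\<close>

theorem proposition1p4:
  fixes p :: "int \<Rightarrow> real" and v :: real
  assumes "gamma' p v > 0"
  shows "\<forall>t0 x0.
    ((\<forall>T. ereal T > ereal (2 * pi) / gamma' p v \<longrightarrow> observability_inequality p v t0 x0 T)
       \<longleftrightarrow> Pi_set p v = {}) \<and>
    (Pi_set p v = {} \<longrightarrow>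
       (\<forall>T. \<forall>u0\<in>L2_circle. \<forall>u. solution p u0 u \<longrightarrow> (\<exists>f. line_restriction u t0 x0 v T f)))"
proof (intro allI conjI)
  fix t0 x0
  obtain T where "ereal T > ereal (2 * pi) / gamma' p v"
    using gamma'_obtain_time[OF assms] by blast
  then show "(\<forall>T. ereal T > ereal (2 * pi) / gamma' p v \<longrightarrow> observability_inequality p v t0 x0 T)
       \<longleftrightarrow> Pi_set p v = {}"
    using not_observable_if_Pi_nonempty observability_if_Pi_empty[OF assms] by blast
  show "Pi_set p v = {} \<longrightarrow>
       (\<forall>T. \<forall>u0\<in>L2_circle. \<forall>u. solution p u0 u \<longrightarrow> (\<exists>f. line_restriction u t0 x0 v T f))"
    using line_restriction_exists[OF assms] by blast
qed

end
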